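(* There exist uncountably many pairwise non-homeomorphic minimal compact metric spaces $X$ whose homeomorphism group $H(X)$ is degenerate, i.e. $H(X)=\{\mathrm{id}_X\}$. Moreover, for every real number $r\ge 0$ there exists such a space $X$ (with $H(X)=\{\mathrm{id}_X\}$) admitting a minimal map $f:X\to X$ whose topological entropy equals $r$.
   Context: A continuous map $T:X\to X$ on a compact metric space $X$ is minimal if for every $x\in X$ the forward orbit $\{T^n(x):n\in\mathbb{N}\}$ is dense in $X$; a compact space is minimal if it admits a minimal map. $H(X)$ denotes the group of all homeomorphisms of $X$. *)

theory Defs
  imports "HOL-Analysis.Analysis"
begin

text \<open>Ambient space: the countable product nat => real (Hilbert-cube-like, metrizable,
  metric from HOL-Analysis Function_Metric inducing the product topology).  Every compact
  metric space is homeomorphic to a compact subset of it.\<close>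

type_synonym point = "nat \<Rightarrow> real"

definition minimal_map :: "('a::topological_space \<Rightarrow> 'a) \<Rightarrow> 'a set \<Rightarrow> bool" where
  "minimal_map T X \<longleftrightarrow> continuous_on X T \<and> T ` X \<subseteq> X \<and>
     (\<forall>x\<in>X. X \<subseteq> closure {(T ^^ n) x | n. True})"

definition minimal_space :: "'a::topological_space set \<Rightarrow> bool" where
  "minimal_space X \<longleftrightarrow> (\<exists>T. minimal_map T X)"

definition degenerate_homeo_group :: "'a::topological_space set \<Rightarrow> bool" where
  "degenerate_homeo_group X \<longleftrightarrow>
     (\<forall>h g. homeomorphism X X h g \<longrightarrow> (\<forall>x\<in>X. h x = x))"

definition separated_set :: "('a::metric_space \<Rightarrow> 'a) \<Rightarrow> 'a set \<Rightarrow> nat \<Rightarrow> real \<Rightarrow> 'a set \<Rightarrow> bool" where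
  "separated_set T X n eps E \<longleftrightarrow> finite E \<and> E \<subseteq> X \<and>
     (\<forall>x\<in>E. \<forall>y\<in>E. x \<noteq> y \<longrightarrow> (\<exists>k<n. dist ((T ^^ k) x) ((T ^^ k) y) > eps))"

definition max_separated :: "('a::metric_space \<Rightarrow> 'a) \<Rightarrow> 'a set \<Rightarrow> nat \<Rightarrow> real \<Rightarrow> nat" where
  "max_separated T X n eps = Sup {card E | E. separated_set T X n eps E}"

definition topological_entropy :: "('a::metric_space \<Rightarrow> 'a) \<Rightarrow> 'a set \<Rightarrow> ereal" where
  "topological_entropy T X =
     (SUP eps\<in>{0<..}. limsup (\<lambda>n. ereal (ln (real (max_separated T X n eps)) / real n)))"

end

theory Submission
  imports Defs
begin

text \<open>
  Start from a minimal aperiodic subshift with a marked point \<open>u\<close>, and attach to every \<open>c\<close> in it the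
  values \<open>\<psi> (c), \<psi> (S c), \<psi> (S\<^sup>2 c), \<dots>\<close> along its forward orbit, where \<open>\<psi>\<close> is continuous away from \<open>u\<close>, takes
  values in a hedgehog with infinitely many spokes, and oscillates at \<open>u\<close> so much that every point of the
  hedgehog is a limit value. Keeping only the first \<open>N m\<close> spokes of the \<open>m\<close>-th value and taking the closure
  gives a compact extension on which the shift acts continuously. Its fibre over the \<open>m\<close>-th preimage of
  \<open>u\<close> is a star with \<open>N m\<close> arms, all other fibres are singletons; since the singleton fibres are dense,
  the map is minimal. The base is totally disconnected, so the stars are exactly the nondegenerate
  components. If \<open>N\<close> is strictly increasing with \<open>N 0 \<ge> 3\<close>, the centres of the stars are topologically
  distinguishable from each other and from all other points, and they are dense: hence every
  homeomorphism is the identity, and the range of \<open>N\<close> is a topological invariant of the space.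

  The fibres contribute no entropy, because an orbit visits small neighbourhoods of the aperiodic point
  \<open>u\<close> with small frequency. So it remains to find minimal subshifts of prescribed entropy \<open>r > 0\<close>. They are
  generated by word sets \<open>W n\<close> of length \<open>l n\<close> with \<open>card (W n)\<close> just above \<open>exp (r * l n)\<close>, where every
  word of \<open>W (Suc n)\<close> is a concatenation in which all words of \<open>W n\<close> occur.
\<close>

section \<open>Uniformly recurrent sequences of prescribed complexity\<close>

definition window :: "(int \<Rightarrow> 'a) \<Rightarrow> int \<Rightarrow> nat \<Rightarrow> 'a list" where
  "window c p n = map (\<lambda>i. c (p + int i)) [0..<n]"

lemma length_window [simp]: "length (window c p n) = n"
  by (simp add: window_def)

lemma nth_window [simp]: "i < n \<Longrightarrow> window c p n ! i = c (p + int i)"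
  by (simp add: window_def)

lemma window_eq_iff: "window c p n = window d q n \<longleftrightarrow> (\<forall>i<n. c (p + int i) = d (q + int i))"
  by (auto simp: list_eq_iff_nth_eq)

lemma take_drop_window: "s + m \<le> n \<Longrightarrow> take m (drop s (window c p n)) = window c (p + int s) m"
  by (auto simp: list_eq_iff_nth_eq algebra_simps)

lemma window_append: "window c p (m + n) = window c p m @ window c (p + int m) n"
  by (auto simp: list_eq_iff_nth_eq nth_append algebra_simps)

lemma length_concat_equal_lengths:
  assumes "\<And>b. b \<in> set bs \<Longrightarrow> length b = l"
  shows "length (concat bs) = length bs * l"
  using assms by (induction bs) auto

lemma take_drop_concat_equal_lengths:
  assumes "\<And>b. b \<in> set bs \<Longrightarrow> length b = l" and "t < length bs"
  shows "take l (drop (t * l) (concat bs)) = bs ! t"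
  using assms
proof (induction bs arbitrary: t)
  case (Cons b bs)
  then show ?case by (cases t) auto
qed simp

text \<open>The ratio \<open>A / B\<close> exceeds 1, so its powers outgrow the fixed factor
  \<open>B ^ s\<close>. In the word construction \<open>s\<close> counts blocks that carry no
  freedom and \<open>t\<close> counts free blocks; the extra 1 leaves room for rounding up.\<close>

lemma exists_power_dominates:
  fixes A B :: real
  assumes "1 \<le> B" "B < A"
  shows "\<exists>t. B ^ (s + t) + 1 \<le> A ^ t"
proof -
  have "1 < A / B" using assms by simp
  then obtain t where t: "B ^ s + 1 < (A / B) ^ t"
    using real_arch_pow by blast
  have "B ^ (s + t) + 1 \<le> (B ^ s + 1) * B ^ t"
    using assms by (simp add: power_add algebra_simps)
  also have "\<dots> \<le> (A / B) ^ t * B ^ t"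
    using t assms by (intro mult_right_mono) auto
  also have "\<dots> = A ^ t" using assms by (simp add: power_divide)
  finally show ?thesis by blast
qed

section \<open>Towers of word sets and their bi-infinite limits\<close>

definition joins :: "'a list set \<Rightarrow> 'a list \<Rightarrow> bool" where
  "joins W u \<longleftrightarrow> (\<exists>bs. u = concat bs \<and> set bs \<subseteq> W \<and>
     (\<forall>w\<in>W. \<exists>ys zs. ys \<noteq> [] \<and> zs \<noteq> [] \<and> bs = ys @ w # zs))"

text \<open>The strict lower bound makes the number of words beat \<open>exp (r * l)\<close>, which
  drives the next step of the tower. Together the two bounds leave exactly one possible cardinality
  and pin the growth rate to \<open>r\<close>.\<close>

definition word_level :: "real \<Rightarrow> 'a list set \<Rightarrow> nat \<Rightarrow> bool" where
  "word_level r W l \<longleftrightarrow> finite W \<and> (\<forall>w\<in>W. length w = l) \<and> 1 \<le> l \<and>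
     exp (r * real l) < real (card W) \<and> real (card W) \<le> exp (r * real l) + 1"

text \<open>New words are a list of all old words written twice, followed by \<open>t\<close> free
  blocks. The doubling places an occurrence of each old word strictly inside, as
  \<open>joins\<close> demands. The \<open>2 * a\<close> forced blocks are paid for by taking
  \<open>t\<close> large; surplus words are then discarded.\<close>

lemma word_level_step:
  assumes r: "r > 0" and W: "word_level r W l"
  shows "\<exists>W' l'. word_level r W' l' \<and> l < l' \<and> l dvd l' \<and> (\<forall>u\<in>W'. joins W u)"
proof -
  have fin: "finite W" and len: "\<And>w. w \<in> W \<Longrightarrow> length w = l" and l: "1 \<le> l"
    and card: "exp (r * real l) < real (card W)"
    using W by (auto simp: word_level_def)
  obtain xs where xs: "set xs = W" "distinct xs"
    using finite_distinct_list[OF fin] by blast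
  define a where "a = length xs"
  have a: "card W = a" using xs a_def distinct_card by fastforce
  have B: "1 \<le> exp (r * real l)" using r by simp
  then have a2: "2 \<le> a" using card a by linarith
  obtain t where t: "exp (r * real l) ^ (2 * a + t) + 1 \<le> real a ^ t"
    using exists_power_dominates[OF B card] a by auto
  define l' where "l' = (2 * a + t) * l"
  have el: "exp (r * real l) ^ (2 * a + t) = exp (r * real l')"
    by (simp add: l'_def exp_of_nat_mult[symmetric] algebra_simps)
  define free where "free = {fs. set fs \<subseteq> W \<and> length fs = t}"
  define U where "U = (\<lambda>fs. concat (xs @ xs @ fs)) ` free"
  have "inj_on (\<lambda>fs. concat (xs @ xs @ fs)) free"
  proof (rule inj_onI)
    fix f g assume f: "f \<in> free" and g: "g \<in> free"
      and eq: "concat (xs @ xs @ f) = concat (xs @ xs @ g)"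
    then have "concat f = concat g" by simp
    moreover have "\<forall>(x, y) \<in> set (zip f g). length x = length y"
    proof clarify
      fix x y assume "(x, y) \<in> set (zip f g)"
      then have "x \<in> W" "y \<in> W"
        using f g by (auto simp: free_def dest: set_zip_leftD set_zip_rightD)
      then show "length x = length y" using len by simp
    qed
    ultimately show "f = g" using f g by (intro concat_injective) (auto simp: free_def)
  qed
  then have cU: "card U = a ^ t"
    unfolding U_def free_def using card_lists_length_eq[OF fin, of t] a by (simp add: card_image)
  \<comment> \<open>This number is the only cardinality that \<open>word_level\<close> admits at
    length \<open>l'\<close>.\<close>
  have "nat \<lfloor>exp (r * real l')\<rfloor> + 1 \<le> card U"
  proof -
    have "real (nat \<lfloor>exp (r * real l')\<rfloor> + 1) \<le> exp (r * real l') + 1" by simp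
    also have "\<dots> \<le> real (card U)" using t el cU by simp
    finally show ?thesis by linarith
  qed
  then obtain W' where W': "W' \<subseteq> U" "card W' = nat \<lfloor>exp (r * real l')\<rfloor> + 1" "finite W'"
    using obtain_subset_with_card_n by metis
  have joined: "joins W u" "length u = l'" if u: "u \<in> W'" for u
  proof -
    obtain fs where fs: "fs \<in> free" "u = concat (xs @ xs @ fs)"
      using u W' U_def by auto
    have sub: "set (xs @ xs @ fs) \<subseteq> W" using xs fs free_def by auto
    have "\<exists>ys zs. ys \<noteq> [] \<and> zs \<noteq> [] \<and> xs @ xs @ fs = ys @ w # zs" if w: "w \<in> W" for w
    proof -
      obtain ps qs where pq: "xs = ps @ w # qs" using w xs split_list by metis
      show ?thesis
      proof (cases "ps = []")
        case True
        then have "qs \<noteq> []" using pq a2 a_def by auto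
        then show ?thesis using pq True
          by (intro exI[of _ "xs @ ps"] exI[of _ "qs @ fs"]) auto
      next
        case False
        then show ?thesis using pq
          by (intro exI[of _ ps] exI[of _ "qs @ xs @ fs"]) auto
      qed
    qed
    then show "joins W u" using fs sub unfolding joins_def by blast
    have "length u = length (xs @ xs @ fs) * l"
      unfolding fs(2) by (rule length_concat_equal_lengths) (use sub len in auto)
    then show "length u = l'" using fs by (simp add: free_def l'_def a_def algebra_simps)
  qed
  have "l < l'"
  proof -
    have "1 * l < (2 * a + t) * l" using a2 l by (intro mult_strict_right_mono) auto
    then show ?thesis by (simp add: l'_def)
  qed
  moreover have "l dvd l'" by (simp add: l'_def)
  moreover have "word_level r W' l'"
    unfolding word_level_def using W' joined l \<open>l < l'\<close> by (auto; linarith)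
  ultimately show ?thesis using joined by blast
qed

lemma word_level_start:
  assumes "r > 0"
  shows "word_level r ((\<lambda>i. [i]) ` {..<nat \<lfloor>exp r\<rfloor> + 1}) 1"
proof -
  have "card ((\<lambda>i::nat. [i]) ` {..<nat \<lfloor>exp r\<rfloor> + 1}) = nat \<lfloor>exp r\<rfloor> + 1"
    by (subst card_image) (auto simp: inj_on_def)
  then show ?thesis using assms unfolding word_level_def
    by (auto; linarith)
qed

locale word_tower =
  fixes r :: real and W :: "nat \<Rightarrow> nat list set" and l :: "nat \<Rightarrow> nat"
  assumes r: "r > 0"
    and level: "\<And>n. word_level r (W n) (l n)"
    and l_Suc: "\<And>n. l n < l (Suc n)" "\<And>n. l n dvd l (Suc n)"
    and joins_W: "\<And>n u. u \<in> W (Suc n) \<Longrightarrow> joins (W n) u"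
begin

lemma W_length: "w \<in> W n \<Longrightarrow> length w = l n"
  and finite_W: "finite (W n)"
  and l_ge_1: "1 \<le> l n"
  and card_W: "exp (r * real (l n)) < real (card (W n))" "real (card (W n)) \<le> exp (r * real (l n)) + 1"
  using level[of n] by (auto simp: word_level_def)

lemma l_ge: "n < l n"
proof (induction n)
  case 0 then show ?case using l_ge_1[of 0] by simp
next
  case (Suc n) then show ?case using l_Suc(1)[of n] by simp
qed

lemma l_dvd: "m \<le> n \<Longrightarrow> l m dvd l n"
  by (induction n rule: dec_induct) (auto intro: dvd_trans l_Suc)

lemma W_nonempty: "W n \<noteq> {}"
  using card_W(1)[of n] by (metis card.empty exp_gt_zero less_asym of_nat_0)

lemma concat_of_lower_level:
  assumes "j \<le> k" "u \<in> W k"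
  shows "\<exists>bs. u = concat bs \<and> set bs \<subseteq> W j"
  using assms
proof (induction k arbitrary: u rule: dec_induct)
  case base
  then show ?case by (intro exI[of _ "[u]"]) auto
next
  case (step k)
  then obtain bs where bs: "u = concat bs" "set bs \<subseteq> W k"
    using joins_W unfolding joins_def by blast
  then have "\<forall>b\<in>set bs. \<exists>cs. b = concat cs \<and> set cs \<subseteq> W j" using step by blast
  then obtain f where f: "\<And>b. b \<in> set bs \<Longrightarrow> b = concat (f b) \<and> set (f b) \<subseteq> W j" by metis
  then have "u = concat (concat (map f bs))"
    unfolding bs(1) by (induction bs) auto
  moreover have "set (concat (map f bs)) \<subseteq> W j" using f by auto
  ultimately show ?case by blast
qed

text \<open>A word of level \<open>k\<close> is cut into pieces of the common length
  \<open>l j\<close>, so a position that is a multiple of \<open>l j\<close> falls exactly on a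
  cut.\<close>

lemma aligned_block_in_W:
  assumes "j \<le> k" "u \<in> W k" "(t + 1) * l j \<le> l k"
  shows "take (l j) (drop (t * l j) u) \<in> W j"
proof -
  obtain bs where bs: "u = concat bs" "set bs \<subseteq> W j"
    using concat_of_lower_level assms by blast
  have "length u = length bs * l j"
    unfolding bs(1) by (rule length_concat_equal_lengths) (use bs W_length in auto)
  then have "(t + 1) * l j \<le> length bs * l j" using assms W_length by auto
  then have "t + 1 \<le> length bs" using l_ge_1[of j] by (subst (asm) mult_le_cancel2) auto
  then have "t < length bs" by simp
  then show ?thesis
    using take_drop_concat_equal_lengths[of bs "l j" t] bs W_length nth_mem by (metis subsetD)
qed

lemma W_word_occurs:
  assumes "u \<in> W (Suc j)" "w \<in> W j"
  shows "\<exists>s. s + l j \<le> l (Suc j) \<and> take (l j) (drop s u) = w"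
proof -
  obtain bs where bs: "u = concat bs" "set bs \<subseteq> W j" "w \<in> set bs"
    using joins_W[OF assms(1)] assms(2) unfolding joins_def by fastforce
  have len: "\<And>b. b \<in> set bs \<Longrightarrow> length b = l j" using bs W_length by auto
  obtain t where t: "t < length bs" "bs ! t = w" using bs(3) by (metis in_set_conv_nth)
  have "length u = length bs * l j"
    unfolding bs(1) by (rule length_concat_equal_lengths) (use len in auto)
  then have e: "l (Suc j) = length bs * l j" using W_length[OF assms(1)] by simp
  have "(t + 1) * l j \<le> length bs * l j" using t by (intro mult_right_mono) auto
  then have "t * l j + l j \<le> l (Suc j)" using e by simp
  moreover have "take (l j) (drop (t * l j) u) = w"
    unfolding bs(1) using take_drop_concat_equal_lengths[OF len t(1)] t by simp
  ultimately show ?thesis by blast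
qed

text \<open>The nonempty extensions on both sides let the words exhaust the integers. Divisibility
  of \<open>length (x k)\<close> keeps the block grids of all lower levels aligned.\<close>

lemma nested_words:
  obtains v x y where "\<And>k. v k \<in> W k" "\<And>k. v (Suc k) = x k @ v k @ y k"
    "\<And>k. x k \<noteq> []" "\<And>k. y k \<noteq> []" "\<And>k. l k dvd length (x k)"
proof -
  let ?Q = "\<lambda>k u u'. \<exists>p q. u' = p @ u @ q \<and> p \<noteq> [] \<and> q \<noteq> [] \<and> l k dvd length p"
  have step: "\<exists>u'. u' \<in> W (Suc k) \<and> ?Q k u u'" if u: "u \<in> W k" for k u
  proof -
    obtain u' where u': "u' \<in> W (Suc k)" using W_nonempty by blast
    obtain bs ys zs where bs: "u' = concat bs" "set bs \<subseteq> W k" "ys \<noteq> []" "zs \<noteq> []" "bs = ys @ u # zs"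
      using joins_W[OF u'] u unfolding joins_def by blast
    have len: "length (concat ys) = length ys * l k" "length (concat zs) = length zs * l k"
      by (rule length_concat_equal_lengths; use bs W_length in auto)+
    have "concat ys \<noteq> []" "concat zs \<noteq> []"
      using len bs l_ge_1[of k] by (metis list.size(3) length_0_conv mult_is_0 not_one_le_zero)+
    moreover have "l k dvd length (concat ys)" using len by simp
    moreover have "u' = concat ys @ u @ concat zs" using bs by simp
    ultimately show ?thesis using u' by blast
  qed
  have "\<exists>v. \<forall>k. v k \<in> W k \<and> ?Q k (v k) (v (Suc k))"
    by (rule dependent_nat_choice) (use W_nonempty step in \<open>auto simp: ex_in_conv\<close>)
  then obtain v where v: "\<And>k. v k \<in> W k" "\<And>k. ?Q k (v k) (v (Suc k))" by blast
  then obtain x y where "\<And>k. v (Suc k) = x k @ v k @ y k \<and> x k \<noteq> [] \<and> y k \<noteq> [] \<and> l k dvd length (x k)"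
    by metis
  then show thesis using v that by blast
qed

text \<open>The nested words are superposed, with \<open>v k\<close> starting at position
  \<open>- a k\<close>, where \<open>a k\<close> is the total length added on the left. Modulo
  \<open>l j\<close> the offsets \<open>a k\<close> with \<open>k \<ge> j\<close> all agree, so the
  whole sequence is cut into words of \<open>W j\<close> along one grid with origin
  \<open>z j = - a j\<close>.\<close>

lemma bi_infinite_limit:
  obtains c :: "int \<Rightarrow> nat" and z :: "nat \<Rightarrow> int" where
    "\<And>j t. window c (z j + t * int (l j)) (l j) \<in> W j"
    "\<And>j. z j \<le> - int j" "\<And>j. int j < z j + int (l j)"
proof -
  obtain v x y where v: "\<And>k. v k \<in> W k" "\<And>k. v (Suc k) = x k @ v k @ y k"
    and ne: "\<And>k. x k \<noteq> []" "\<And>k. y k \<noteq> []" and dvd: "\<And>k. l k dvd length (x k)"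
    by (rule nested_words) blast
  define a where "a k = (\<Sum>i<k. length (x i))" for k
  have a_Suc: "a (Suc k) = a k + length (x k)" for k by (simp add: a_def)
  have x_pos: "0 < length (x k)" "0 < length (y k)" for k using ne by auto
  have a_ge: "k \<le> a k" for k
  proof (induction k)
    case (Suc k) then show ?case using x_pos(1)[of k] unfolding a_Suc by linarith
  qed simp
  have l_eq: "l (Suc k) = length (x k) + l k + length (y k)" for k
    using W_length[OF v(1), of "Suc k"] W_length[OF v(1), of k] by (simp add: v(2))
  have a_le: "a k + k < l k" for k
  proof (induction k)
    case 0 then show ?case using l_ge_1[of 0] by (simp add: a_def)
  next
    case (Suc k) then show ?case using x_pos[of k] unfolding a_Suc l_eq by linarith
  qed
  have a_mod: "\<exists>q. a k = a j + q * l j" if "j \<le> k" for j k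
    using that
  proof (induction k rule: dec_induct)
    case base show ?case by (intro exI[of _ 0]) simp
  next
    case (step k)
    then obtain q where "a k = a j + q * l j" by blast
    moreover obtain q' where "length (x k) = l j * q'"
      using l_dvd[OF step(1)] dvd[of k] dvd_trans by (metis dvdE)
    ultimately show ?case by (intro exI[of _ "q + q'"]) (simp add: a_Suc algebra_simps)
  qed
  \<comment> \<open>By \<open>a_ge\<close> and \<open>a_le\<close> the word \<open>v k\<close>
    covers all positions from \<open>-k\<close> to \<open>k\<close>, so index
    \<open>\<bar>i\<bar>\<close> suffices; \<open>c_eq\<close> shows that every later word reads the
    same letter.\<close>
  define c where "c i = v (nat \<bar>i\<bar>) ! nat (i + int (a (nat \<bar>i\<bar>)))" for i
  have c_eq: "c i = v k ! nat (i + int (a k))" if "nat \<bar>i\<bar> \<le> k" for i k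
    using that
  proof (induction k rule: dec_induct)
    case base show ?case by (simp add: c_def)
  next
    case (step k)
    have i: "0 \<le> i + int (a k)" "i + int (a k) < int (l k)"
      using step(1) a_ge[of k] a_le[of k] by linarith+
    have "nat (i + int (a (Suc k))) = length (x k) + nat (i + int (a k))"
      using i by (simp add: a_Suc)
    then have "v (Suc k) ! nat (i + int (a (Suc k))) = v k ! nat (i + int (a k))"
      using i W_length[OF v(1), of k] by (simp add: v(2) nth_append nat_less_iff)
    then show ?case using step by simp
  qed
  have win: "window c p n = take n (drop (nat (p + int (a k))) (v k))"
    if "nat \<bar>p\<bar> \<le> k" "nat \<bar>p + int n\<bar> \<le> k" for p n k
  proof (rule nth_equalityI)
    have b: "0 \<le> p + int (a k)" "p + int n + int (a k) < int (l k)"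
      using that a_ge[of k] a_le[of k] by linarith+
    then show "length (window c p n) = length (take n (drop (nat (p + int (a k))) (v k)))"
      using W_length[OF v(1), of k] by simp
    fix i assume "i < length (window c p n)"
    then have i: "i < n" by simp
    have "c (p + int i) = v k ! nat (p + int i + int (a k))"
      by (rule c_eq) (use that i in linarith)
    moreover have "nat (p + int i + int (a k)) = nat (p + int (a k)) + i" using b by linarith
    ultimately show "window c p n ! i = take n (drop (nat (p + int (a k))) (v k)) ! i"
      using i b W_length[OF v(1), of k] by simp
  qed
  have blocks: "window c (- int (a j) + t * int (l j)) (l j) \<in> W j" for j t
  proof -
    define p where "p = - int (a j) + t * int (l j)"
    \<comment> \<open>Large enough for \<open>v k\<close> to cover the whole window that starts at
      \<open>p\<close>.\<close>
    define k where "k = max j (max (nat \<bar>p\<bar>) (nat \<bar>p + int (l j)\<bar>))"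
    have k: "j \<le> k" "nat \<bar>p\<bar> \<le> k" "nat \<bar>p + int (l j)\<bar> \<le> k" by (simp_all only: k_def le_max_iff_disj order_refl simp_thms)
    obtain q where q: "a k = a j + q * l j" using a_mod[OF k(1)] by blast
    have e: "p + int (a k) = (t + int q) * int (l j)" by (simp add: p_def q algebra_simps)
    have b: "0 \<le> p + int (a k)" "p + int (l j) + int (a k) < int (l k)"
      using k a_ge[of k] a_le[of k] by linarith+
    then have tq: "0 \<le> t + int q" using e l_ge_1[of j] by (metis of_nat_0_less_iff zero_le_mult_iff order.strict_trans2 zero_less_one not_le)
    have s: "nat (p + int (a k)) = nat (t + int q) * l j"
      using e tq by (simp add: nat_mult_distrib)
    have "int ((nat (t + int q) + 1) * l j) < int (l k)"
      using b e tq by (simp add: algebra_simps)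
    then have "(nat (t + int q) + 1) * l j \<le> l k" by linarith
    then have "take (l j) (drop (nat (t + int q) * l j) (v k)) \<in> W j"
      by (rule aligned_block_in_W[OF k(1) v(1)])
    then show ?thesis using win[OF k(2,3)] s by (simp add: p_def)
  qed
  show thesis
    by (rule that[of c "\<lambda>j. - int (a j)"]) (use blocks a_ge a_le in \<open>auto simp: algebra_simps\<close>, metis add.commute of_nat_add of_nat_less_iff)
qed

end

section \<open>Recurrence and complexity of the limit sequence\<close>

definition complexity :: "(int \<Rightarrow> 'a) \<Rightarrow> nat \<Rightarrow> nat" where
  "complexity c n = card (range (\<lambda>p. window c p n))"

text \<open>Every central word returns with bounded gaps. This is what makes the orbit closure a
  minimal subshift.\<close>

definition uniformly_recurrent :: "(int \<Rightarrow> 'a) \<Rightarrow> bool" where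
  "uniformly_recurrent c \<longleftrightarrow>
     (\<forall>m. \<exists>R. \<forall>p. \<exists>q. p \<le> q \<and> q \<le> p + R \<and> (\<forall>i. \<bar>i\<bar> \<le> int m \<longrightarrow> c (q + i) = c i))"

context word_tower begin

context
  fixes c :: "int \<Rightarrow> nat" and z :: "nat \<Rightarrow> int"
  assumes blocks: "\<And>j t. window c (z j + t * int (l j)) (l j) \<in> W j"
    and z: "\<And>j. z j \<le> - int j" "\<And>j. int j < z j + int (l j)"
begin

lemma next_block:
  obtains t s where "p = z j + t * int (l j) + int s" "s < l j"
proof
  have "0 < int (l j)" using l_ge_1[of j] by simp
  then show "p = z j + ((p - z j) div int (l j)) * int (l j) + int (nat ((p - z j) mod int (l j)))"
    "nat ((p - z j) mod int (l j)) < l j" 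
    by (simp_all add: nat_less_iff)
qed

text \<open>The first complete block of level \<open>Suc j\<close> after \<open>p\<close> contains
  every word of \<open>W j\<close>. The factor 2 accounts for the rest of the current block and one
  full block.\<close>

lemma W_words_recur:
  assumes w: "w \<in> W j"
  shows "\<exists>q. p \<le> q \<and> q \<le> p + 2 * int (l (Suc j)) \<and> window c q (l j) = w"
proof -
  let ?L = "l (Suc j)"
  obtain t s where ts: "p = z (Suc j) + t * int ?L + int s" "s < ?L"
    by (rule next_block)
  let ?p = "z (Suc j) + (t + 1) * int ?L"
  obtain i where i: "i + l j \<le> ?L" "take (l j) (drop i (window c ?p ?L)) = w"
    using W_word_occurs[OF blocks w] by blast
  then have "window c (?p + int i) (l j) = w" using take_drop_window by metis
  moreover have "p \<le> ?p + int i" "?p + int i \<le> p + 2 * int ?L"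
    using ts i(1) by (auto simp: algebra_simps)
  ultimately show ?thesis by blast
qed

text \<open>The block of level \<open>m\<close> at \<open>z m\<close> contains the central window of
  radius \<open>m\<close>, and it recurs as a member of \<open>W m\<close>.\<close>

lemma limit_uniformly_recurrent: "uniformly_recurrent c"
  unfolding uniformly_recurrent_def
proof (intro allI)
  fix m
  show "\<exists>R. \<forall>p. \<exists>q. p \<le> q \<and> q \<le> p + R \<and> (\<forall>i. \<bar>i\<bar> \<le> int m \<longrightarrow> c (q + i) = c i)"
  proof (rule exI, rule allI)
    fix p
    let ?w = "window c (z m) (l m)"
    have "?w \<in> W m" using blocks[of m 0] by simp
    then obtain q where q: "p + z m \<le> q" "q \<le> p + z m + 2 * int (l (Suc m))" "window c q (l m) = ?w"
      using W_words_recur by blast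
    have "c (q - z m + i) = c i" if i: "\<bar>i\<bar> \<le> int m" for i
    proof -
      have "nat (i - z m) < l m" "int (nat (i - z m)) = i - z m" using i z[of m] by linarith+
      then show ?thesis using q(3) unfolding window_eq_iff by (metis add.commute add_diff_eq diff_add_eq diff_add_cancel)
    qed
    then show "\<exists>q. p \<le> q \<and> q \<le> p + 2 * int (l (Suc m)) \<and> (\<forall>i. \<bar>i\<bar> \<le> int m \<longrightarrow> c (q + i) = c i)"
      using q by (intro exI[of _ "q - z m"]) auto
  qed
qed

text \<open>A window is determined by its offset in the first block that it meets and by the next
  blocks. The \<open>+ 2\<close> covers the partial blocks at the two ends.\<close>

lemma windows_count:
  shows "finite (range (\<lambda>p. window c p n))" "complexity c n \<le> l j * card (W j) ^ (n div l j + 2)"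
proof -
  let ?b = "n div l j + 2"
  let ?L = "{bs. set bs \<subseteq> W j \<and> length bs = ?b}"
  have lp: "0 < l j" using l_ge_1[of j] by simp
  have sub: "range (\<lambda>p. window c p n) \<subseteq> (\<lambda>(s, bs). take n (drop s (concat bs))) ` ({..<l j} \<times> ?L)"
  proof clarify
    fix p
    obtain t s where ts: "p = z j + t * int (l j) + int s" "s < l j" by (rule next_block)
    let ?bs = "\<lambda>k. map (\<lambda>i. window c (z j + (t + int i) * int (l j)) (l j)) [0..<k]"
    have conc: "concat (?bs k) = window c (z j + t * int (l j)) (k * l j)" for k
    proof (induction k)
      case (Suc k)
      then show ?case
        using window_append[of c "z j + t * int (l j)" "k * l j" "l j"] by (simp add: algebra_simps)
    qed (simp add: window_def)
    have "n < (n div l j) * l j + l j"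
      by (metis add.commute div_mult_mod_eq lp mod_less_divisor nat_add_left_cancel_less)
    then have "s + n \<le> ?b * l j" using ts(2) by simp
    then have "window c p n = take n (drop s (concat (?bs ?b)))"
      unfolding conc by (subst take_drop_window) (use ts in auto)
    moreover have "(s, ?bs ?b) \<in> {..<l j} \<times> ?L" using ts blocks by (auto simp del: upt_Suc)
    ultimately show "window c p n \<in> (\<lambda>(s, bs). take n (drop s (concat bs))) ` ({..<l j} \<times> ?L)"
      by (intro image_eqI[of _ _ "(s, ?bs ?b)"]) auto
  qed
  have fin: "finite ({..<l j} \<times> ?L)" using finite_lists_length_eq[OF finite_W] by blast
  then show "finite (range (\<lambda>p. window c p n))" using sub finite_surj by blast
  have "card (range (\<lambda>p. window c p n)) \<le> card ({..<l j} \<times> ?L)"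
    using sub fin by (rule surj_card_le[rotated])
  also have "\<dots> = l j * card (W j) ^ ?b"
    by (simp add: card_cartesian_product card_lists_length_eq[OF finite_W])
  finally show "complexity c n \<le> l j * card (W j) ^ ?b" by (simp add: complexity_def)
qed

lemma complexity_upper:
  assumes \<eta>: "\<eta> > 0"
  shows "\<forall>\<^sub>F n in sequentially. real (complexity c n) \<le> exp ((r + \<eta>) * real n)"
proof -
  \<comment> \<open>Bounding \<open>card (W j)\<close> by \<open>exp (r * L + 1)\<close> costs a
    rate of \<open>1 / L\<close>, which this choice keeps below half of \<open>\<eta>\<close>. The
    other half absorbs the constant factor \<open>K\<close>.\<close>
  obtain j :: nat where j: "real j > 2 / \<eta>" using reals_Archimedean2 by blast
  define L where "L = real (l j)"
  have L: "L > 2 / \<eta>" "L \<ge> 1" using j l_ge[of j] l_ge_1[of j] by (auto simp: L_def)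
  have A: "real (card (W j)) \<le> exp (r * L + 1)"
  proof -
    have "real (card (W j)) \<le> exp (r * L) + 1" using card_W(2) by (simp add: L_def)
    also have "\<dots> \<le> 2 * exp (r * L)" using r L by simp
    also have "\<dots> \<le> exp 1 * exp (r * L)" using exp_ge_add_one_self[of 1] by (intro mult_right_mono) auto
    finally show ?thesis by (simp add: exp_add mult.commute)
  qed
  define K where "K = L * exp (2 * (r * L + 1))"
  have K: "K > 0" using L by (simp add: K_def)
  have bound: "real (complexity c n) \<le> K * exp ((r + 1 / L) * real n)" for n
  proof -
    have "real (complexity c n) \<le> real (l j * card (W j) ^ (n div l j + 2))"
      using windows_count(2) by (simp only: of_nat_le_iff)
    also have "\<dots> \<le> L * exp (r * L + 1) ^ (n div l j + 2)"
      using A L by (simp add: L_def mult_left_mono power_mono del: power_add power_add_numeral power_Suc add_2_eq_Suc')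
    also have "\<dots> = L * exp (real (n div l j + 2) * (r * L + 1))"
      by (simp only: exp_of_nat_mult)
    also have "\<dots> \<le> L * exp ((real n / L + 2) * (r * L + 1))"
    proof -
      have "real (n div l j) \<le> real n / L" using of_nat_div_le_of_nat[of n "l j"] by (simp add: L_def)
      then have "real (n div l j + 2) * (r * L + 1) \<le> (real n / L + 2) * (r * L + 1)"
        using r L by (intro mult_right_mono) auto
      then show ?thesis using L by simp
    qed
    also have "(real n / L + 2) * (r * L + 1) = (r + 1 / L) * real n + 2 * (r * L + 1)"
      using L by (simp add: field_simps)
    finally show ?thesis by (simp add: K_def exp_add algebra_simps)
  qed
  have "\<forall>\<^sub>F n in sequentially. ln K / (\<eta> / 2) \<le> real n"
    using eventually_ge_at_top[of "nat \<lceil>ln K / (\<eta> / 2)\<rceil>"] by eventually_elim linarith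
  then show ?thesis
  proof eventually_elim
    case (elim n)
    have "1 / L \<le> \<eta> / 2" using L \<eta> by (simp add: field_simps)
    then have "(r + 1 / L) * real n \<le> (r + \<eta> / 2) * real n" by (intro mult_right_mono) auto
    moreover have "ln K \<le> \<eta> / 2 * real n" using elim \<eta> by (simp add: field_simps)
    moreover have "(r + \<eta> / 2) * real n + \<eta> / 2 * real n = (r + \<eta>) * real n"
      by (simp add: algebra_simps)
    ultimately have "ln K + (r + 1 / L) * real n \<le> (r + \<eta>) * real n" by linarith
    then have "exp (ln K + (r + 1 / L) * real n) \<le> exp ((r + \<eta>) * real n)" by simp
    then show ?case using bound[of n] K by (simp add: exp_add)
  qed
qed

text \<open>All words of \<open>W N\<close> occur in \<open>c\<close>, which controls the lengths
  \<open>l N\<close> only. Infinitely many lengths are enough for a lower bound on a limsup.\<close>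

lemma complexity_lower: "\<exists>\<^sub>F n in sequentially. exp (r * real n) \<le> real (complexity c n)"
  unfolding frequently_sequentially
proof
  fix N
  have "W N \<subseteq> range (\<lambda>p. window c p (l N))" using W_words_recur by blast
  then have "card (W N) \<le> complexity c (l N)"
    unfolding complexity_def using windows_count(1) by (intro card_mono)
  then have "exp (r * real (l N)) \<le> real (complexity c (l N))" using card_W(1)[of N] by linarith
  then show "\<exists>n\<ge>N. exp (r * real n) \<le> real (complexity c n)"
    using l_ge[of N] less_imp_le by blast
qed

end

end

theorem uniformly_recurrent_with_complexity_rate:
  assumes r: "r > 0"
  obtains c :: "int \<Rightarrow> nat" and b where "\<And>i. c i < b" "uniformly_recurrent c"
    "\<And>\<eta>. \<eta> > 0 \<Longrightarrow> \<forall>\<^sub>F n in sequentially. real (complexity c n) \<le> exp ((r + \<eta>) * real n)"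
    "\<exists>\<^sub>F n in sequentially. exp (r * real n) \<le> real (complexity c n)"
proof -
  let ?W0 = "(\<lambda>i::nat. [i]) ` {..<nat \<lfloor>exp r\<rfloor> + 1}"
  let ?Q = "\<lambda>V V'. snd V < snd V' \<and> snd V dvd snd V' \<and> (\<forall>u\<in>fst V'. joins (fst V) u)"
  \<comment> \<open>The clause for \<open>n = 0\<close> keeps the initial alphabet visible after the
    choice; it later bounds the letters of \<open>c\<close>.\<close>
  have "\<exists>V :: nat \<Rightarrow> nat list set \<times> nat. \<forall>n. (word_level r (fst (V n)) (snd (V n)) \<and> (n = 0 \<longrightarrow> V n = (?W0, 1)))
     \<and> ?Q (V n) (V (Suc n))"
  proof (rule dependent_nat_choice)
    show "\<exists>V. word_level r (fst V) (snd V) \<and> (0 = (0::nat) \<longrightarrow> V = (?W0, 1))"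
      using word_level_start[OF r] by auto
    fix V :: "nat list set \<times> nat" and n :: nat
    assume "word_level r (fst V) (snd V) \<and> (n = 0 \<longrightarrow> V = (?W0, 1))"
    then obtain W' l' where "word_level r W' l'" "snd V < l'" "snd V dvd l'" "\<forall>u\<in>W'. joins (fst V) u"
      using word_level_step[OF r] by blast
    then show "\<exists>V'. (word_level r (fst V') (snd V') \<and> (Suc n = 0 \<longrightarrow> V' = (?W0, 1))) \<and> ?Q V V'"
      by (intro exI[of _ "(W', l')"]) auto
  qed
  then obtain V :: "nat \<Rightarrow> nat list set \<times> nat" where V: "\<And>n. word_level r (fst (V n)) (snd (V n))" "V 0 = (?W0, 1)"
    "\<And>n. ?Q (V n) (V (Suc n))" by blast
  interpret word_tower r "\<lambda>n. fst (V n)" "\<lambda>n. snd (V n)"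
    by unfold_locales (use V r in auto)
  obtain c z where cz: "\<And>j t. window c (z j + t * int (snd (V j))) (snd (V j)) \<in> fst (V j)"
    "\<And>j. z j \<le> - int j" "\<And>j. int j < z j + int (snd (V j))"
    by (rule bi_infinite_limit) blast
  have "c i < nat \<lfloor>exp r\<rfloor> + 1" for i
    using cz(1)[of 0 "i - z 0"] V(2) by (auto simp: window_def)
  then show thesis
    using that limit_uniformly_recurrent[OF cz] complexity_upper[OF cz] complexity_lower[OF cz] by metis
qed

section \<open>The extension and its minimality\<close>

definition shift :: "int \<Rightarrow> (int \<Rightarrow> 'a) \<Rightarrow> int \<Rightarrow> 'a" where
  "shift p c = (\<lambda>i. c (i + p))"

text \<open>The sets of all \<open>d\<close> with \<open>agree m c d\<close> are the basic cylinder
  neighbourhoods of \<open>c\<close>; they replace a topology on symbolic sequences.\<close>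

definition agree :: "nat \<Rightarrow> (int \<Rightarrow> 'a) \<Rightarrow> (int \<Rightarrow> 'a) \<Rightarrow> bool" where
  "agree m c d \<longleftrightarrow> (\<forall>i. \<bar>i\<bar> \<le> int m \<longrightarrow> c i = d i)"

lemma shift_shift [simp]: "shift p (shift q c) = shift (p + q) c"
  by (simp add: shift_def add.assoc)

lemma shift_0 [simp]: "shift 0 c = c"
  by (simp add: shift_def)

lemma shift_eq_iff: "shift p c = d \<longleftrightarrow> c = shift (- p) d"
  by (auto simp: shift_def fun_eq_iff) (metis diff_add_cancel)

lemma agree_refl [simp]: "agree m c c"
  by (simp add: agree_def)

lemma agree_sym: "agree m c d \<Longrightarrow> agree m d c"
  by (simp add: agree_def)

lemma agree_trans: "agree m c d \<Longrightarrow> agree m d e \<Longrightarrow> agree m c e"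
  by (simp add: agree_def)

lemma agree_mono: "agree n c d \<Longrightarrow> m \<le> n \<Longrightarrow> agree m c d"
  unfolding agree_def by (meson of_nat_le_iff order_trans)

lemma agree_shift:
  assumes "agree n c d" "int m + \<bar>p\<bar> \<le> int n"
  shows "agree m (shift p c) (shift p d)"
  using assms unfolding agree_def shift_def
  by (metis abs_triangle_ineq add_mono order_refl order_trans)

lemma agree_all_imp_eq: "(\<And>m. agree m c d) \<Longrightarrow> c = d"
  unfolding agree_def by (metis ext nat_0_le abs_ge_zero order_refl)

section \<open>Limits in the product space, hedgehogs, and the coding of points\<close>

lemma tendsto_coordinatewise:
  fixes f :: "'a \<Rightarrow> 'i \<Rightarrow> 'b::topological_space"
  shows "(f \<longlongrightarrow> l) F \<longleftrightarrow> (\<forall>i. ((\<lambda>x. f x i) \<longlongrightarrow> l i) F)"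
proof -
  have "(f \<longlongrightarrow> l) F \<longleftrightarrow> limitin (product_topology (\<lambda>i::'i. euclidean :: 'b topology) UNIV) f l F"
    by (simp add: euclidean_product_topology)
  also have "\<dots> \<longleftrightarrow> (\<forall>i. ((\<lambda>x. f x i) \<longlongrightarrow> l i) F)"
    by (simp add: limitin_componentwise)
  finally show ?thesis .
qed

lemma compact_product_intervals: "compact {x :: nat \<Rightarrow> real. \<forall>n. x n \<in> {0..B}}"
proof -
  have "compactin (product_topology (\<lambda>_::nat. euclidean :: real topology) UNIV) (PiE UNIV (\<lambda>_. {0..B}))"
    by (simp add: compactin_PiE)
  moreover have "PiE UNIV (\<lambda>_::nat. {0..B}) = {x. \<forall>n. x n \<in> {0..B}}" by auto
  ultimately show ?thesis by (simp add: euclidean_product_topology)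
qed

lemma eventually_constant_nat:
  assumes "(\<lambda>n. real (f n)) \<longlonglongrightarrow> x"
  shows "\<exists>k. x = real k \<and> (\<forall>\<^sub>F n in sequentially. f n = k)"
proof -
  obtain M where M: "\<And>m n. m \<ge> M \<Longrightarrow> n \<ge> M \<Longrightarrow> dist (real (f m)) (real (f n)) < 1"
    using LIMSEQ_imp_Cauchy[OF assms] unfolding Cauchy_def by (meson zero_less_one)
  have "f n = f M" if "n \<ge> M" for n
    using M[OF that order_refl] by (simp add: dist_real_def)
  then have ev: "\<forall>\<^sub>F n in sequentially. f n = f M"
    unfolding eventually_sequentially by blast
  then have "\<forall>\<^sub>F n in sequentially. real (f n) = real (f M)"
    by eventually_elim simp
  then have "(\<lambda>n. real (f n)) \<longlonglongrightarrow> real (f M)" by (rule tendsto_eventually)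
  then show ?thesis using LIMSEQ_unique[OF assms] ev by blast
qed

lemma dist_fun_small:
  fixes e :: real
  assumes "e > 0"
  shows "\<exists>M. \<exists>\<delta>>0. \<forall>x y :: nat \<Rightarrow> real. (\<forall>n\<le>M. \<bar>x n - y n\<bar> \<le> \<delta>) \<longrightarrow> dist x y < e"
proof -
  obtain M where M: "(1 / 2) ^ M < e / 2"
    using real_arch_pow_inv[of "e / 2" "1 / 2"] assms by auto
  \<comment> \<open>The product metric lists coordinates through \<open>from_nat\<close>, so its
    first \<open>M + 1\<close> terms involve only coordinates up to \<open>M'\<close>.\<close>
  define M' where "M' = Max ((from_nat :: nat \<Rightarrow> nat) ` {..M})"
  have M': "from_nat n \<le> M'" if "n \<le> M" for n using that by (simp add: M'_def)
  have "dist x y < e" if *: "\<forall>n\<le>M'. \<bar>x n - y n\<bar> \<le> e / 4" for x y :: "nat \<Rightarrow> real"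
  proof -
    let ?S = "{dist (x (from_nat n)) (y (from_nat n)) |n. n \<le> M}"
    have "Max ?S \<le> e / 4" using * M' by (subst Max_le_iff) (auto simp: dist_real_def simp del: times_divide_eq_right)
    then show ?thesis using dist_fun_le_dist_first_terms[of x y M] M by linarith
  qed
  then show ?thesis using assms by (intro exI[of _ M'] exI[of _ "e / 4"]) auto
qed

text \<open>At most one coordinate is nonzero. Stating this through products makes it a closed
  condition that passes to coordinatewise limits.\<close>

definition hedgehog :: "(nat \<Rightarrow> real) set" where
  "hedgehog = {v. (\<forall>j. 0 \<le> v j \<and> v j \<le> 1) \<and> (\<forall>i j. i \<noteq> j \<longrightarrow> v i * v j = 0)}"

definition trunc :: "nat \<Rightarrow> (nat \<Rightarrow> real) \<Rightarrow> nat \<Rightarrow> real" where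
  "trunc n v = (\<lambda>j. if j < n then v j else 0)"

definition star :: "nat \<Rightarrow> (nat \<Rightarrow> real) set" where
  "star n = {v \<in> hedgehog. trunc n v = v}"

definition spoke :: "nat \<Rightarrow> real \<Rightarrow> nat \<Rightarrow> real" where
  "spoke i t = (\<lambda>j. if j = i then t else 0)"

lemma spoke_hedgehog: "0 \<le> t \<Longrightarrow> t \<le> 1 \<Longrightarrow> spoke i t \<in> hedgehog"
  by (auto simp: spoke_def hedgehog_def)

lemma hedgehogE:
  assumes "v \<in> hedgehog"
  obtains i t where "0 \<le> t" "t \<le> 1" "v = spoke i t"
proof (cases "\<exists>i. v i \<noteq> 0")
  case True
  then obtain i where "v i \<noteq> 0" by blast
  with assms have "v = spoke i (v i)"
    unfolding hedgehog_def spoke_def fun_eq_iff by (metis (mono_tags, lifting) mem_Collect_eq mult_eq_0_iff)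
  then show ?thesis using that[of "v i" i] assms by (auto simp: hedgehog_def)
next
  case False
  then show ?thesis using that[of 0 0] by (auto simp: spoke_def)
qed

lemma trunc_trunc [simp]: "trunc m (trunc n v) = trunc (min m n) v"
  by (auto simp: trunc_def)

lemma trunc_in_star: "v \<in> hedgehog \<Longrightarrow> trunc n v \<in> star n"
  by (auto simp: star_def hedgehog_def trunc_def)

lemma starD: "v \<in> star n \<Longrightarrow> v \<in> hedgehog" "v \<in> star n \<Longrightarrow> trunc n v = v"
  by (auto simp: star_def)

lemma star_bounds: "v \<in> star n \<Longrightarrow> 0 \<le> v j" "v \<in> star n \<Longrightarrow> v j \<le> 1"
  by (auto simp: star_def hedgehog_def)

text \<open>A point of the extension is coded by an integer-indexed sequence \<open>c\<close> (the base) and a sequence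
  \<open>y\<close> of real vectors (the fibre), merged into a single function on the naturals.\<close>

definition base_ix :: "int \<Rightarrow> nat" where
  "base_ix i = sum_encode (Inl (int_encode i))"

definition fib_ix :: "nat \<Rightarrow> nat \<Rightarrow> nat" where
  "fib_ix m j = sum_encode (Inr (prod_encode (m, j)))"

definition merge :: "(int \<Rightarrow> real) \<Rightarrow> (nat \<Rightarrow> nat \<Rightarrow> real) \<Rightarrow> point" where
  "merge f y n = (case sum_decode n of Inl a \<Rightarrow> f (int_decode a)
                  | Inr a \<Rightarrow> (case prod_decode a of (m, j) \<Rightarrow> y m j))"

lemma merge_simps [simp]: "merge f y (base_ix i) = f i" "merge f y (fib_ix m j) = y m j"
  by (simp_all add: merge_def base_ix_def fib_ix_def)

lemma ix_cases:
  obtains i where "n = base_ix i" | m j where "n = fib_ix m j"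
proof (cases "sum_decode n")
  case (Inl a)
  then have "n = base_ix (int_decode a)" by (metis base_ix_def int_decode_inverse sum_decode_inverse)
  then show ?thesis using that by blast
next
  case (Inr a)
  then have "n = fib_ix (fst (prod_decode a)) (snd (prod_decode a))"
    by (metis fib_ix_def prod.collapse prod_decode_inverse sum_decode_inverse)
  then show ?thesis using that by blast
qed

lemma merge_coordinates: "merge (\<lambda>i. x (base_ix i)) (\<lambda>m j. x (fib_ix m j)) = x"
proof
  fix n show "merge (\<lambda>i. x (base_ix i)) (\<lambda>m j. x (fib_ix m j)) n = x n"
    by (cases n rule: ix_cases) simp_all
qed

abbreviation pt :: "(int \<Rightarrow> nat) \<Rightarrow> (nat \<Rightarrow> nat \<Rightarrow> real) \<Rightarrow> point" where
  "pt c y \<equiv> merge (\<lambda>i. real (c i)) y"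

lemma pt_eq_iff: "pt c y = pt d z \<longleftrightarrow> c = d \<and> y = z"
proof
  assume *: "pt c y = pt d z"
  have "c i = d i" for i using arg_cong[OF *, of "\<lambda>x. x (base_ix i)"] by simp
  moreover have "y m j = z m j" for m j using arg_cong[OF *, of "\<lambda>x. x (fib_ix m j)"] by simp
  ultimately show "c = d \<and> y = z" by blast
qed simp

lemma pt_close:
  assumes "e > 0"
  shows "\<exists>q. \<exists>\<delta>>0. \<forall>c y d z. agree q c d \<longrightarrow> (\<forall>m\<le>q. \<forall>j. \<bar>y m j - z m j\<bar> \<le> \<delta>) \<longrightarrow> dist (pt c y) (pt d z) < e"
proof -
  obtain M \<delta> where M: "\<delta> > 0" "\<And>x y :: nat \<Rightarrow> real. (\<forall>n\<le>M. \<bar>x n - y n\<bar> \<le> \<delta>) \<Longrightarrow> dist x y < e"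
    using dist_fun_small[OF assms] by blast
  \<comment> \<open>The depth of a coordinate: the distance of a base position from 0, or the number
    \<open>m\<close> of a fibre vector. The spoke index is irrelevant because closeness is required
    for all \<open>j\<close>.\<close>
  define rad where "rad n = (case sum_decode n of Inl a \<Rightarrow> nat \<bar>int_decode a\<bar> | Inr a \<Rightarrow> fst (prod_decode a))" for n
  define q where "q = Max (rad ` {..M})"
  have q: "rad n \<le> q" if "n \<le> M" for n using that by (simp add: q_def)
  have "dist (pt c y) (pt d z) < e"
    if a: "agree q c d" "\<forall>m\<le>q. \<forall>j. \<bar>y m j - z m j\<bar> \<le> \<delta>" for c d y z
  proof (rule M(2), intro allI impI)
    fix n assume "n \<le> M"
    then have r: "rad n \<le> q" by (rule q)
    show "\<bar>pt c y n - pt d z n\<bar> \<le> \<delta>"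
    proof (cases n rule: ix_cases)
      case (1 i)
      then have "\<bar>i\<bar> \<le> int q" using r by (simp add: rad_def base_ix_def)
      then show ?thesis using a(1) M(1) 1 by (simp add: agree_def)
    next
      case (2 m j)
      then have "m \<le> q" using r by (simp add: rad_def fib_ix_def)
      then show ?thesis using a(2) 2 by simp
    qed
  qed
  then show ?thesis using M(1) by (intro exI[of _ q] exI[of _ \<delta>]) blast
qed

lemma pt_in_closureI:
  assumes "\<And>q \<delta>. \<delta> > 0 \<Longrightarrow> \<exists>d z. pt d z \<in> S \<and> agree q d c \<and> (\<forall>m\<le>q. \<forall>j. \<bar>z m j - y m j\<bar> \<le> \<delta>)"
  shows "pt c y \<in> closure S"
  unfolding closure_approachable
proof (intro allI impI)
  fix e :: real assume "e > 0"
  then obtain q \<delta> where q: "\<delta> > 0"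
    "\<And>c y d z. agree q c d \<Longrightarrow> (\<forall>m\<le>q. \<forall>j. \<bar>y m j - z m j\<bar> \<le> \<delta>) \<Longrightarrow> dist (pt c y) (pt d z) < e"
    using pt_close by blast
  obtain d z where "pt d z \<in> S" "agree q d c" "\<forall>m\<le>q. \<forall>j. \<bar>z m j - y m j\<bar> \<le> \<delta>"
    using assms[OF q(1)] by blast
  then show "\<exists>x\<in>S. dist x (pt c y) < e" using q(2) by blast
qed

section \<open>The minimal subshift and the function that oscillates at its marked point\<close>

locale recurrent_sequence =
  fixes u :: "int \<Rightarrow> nat" and b :: nat
  assumes u_less: "\<And>i. u i < b"
    and recurrent: "uniformly_recurrent u"
    and aperiodic: "\<And>p. p \<noteq> 0 \<Longrightarrow> shift p u \<noteq> u"
begin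

text \<open>The orbit closure of \<open>u\<close>, expressed by cylinders.\<close>

definition subshift :: "(int \<Rightarrow> nat) set" where
  "subshift = {c. \<forall>m. \<exists>p. agree m c (shift p u)}"

lemma subshiftE:
  assumes "c \<in> subshift" obtains p where "agree m c (shift p u)"
  using assms unfolding subshift_def by blast

lemma shift_subshift: "c \<in> subshift \<Longrightarrow> shift q c \<in> subshift"
  unfolding subshift_def
proof clarify
  fix m assume "\<forall>m. \<exists>p. agree m c (shift p u)"
  then obtain p where "agree (m + nat \<bar>q\<bar>) c (shift p u)" by blast
  then have "agree m (shift q c) (shift (q + p) u)" using agree_shift[of _ c "shift p u" m q] by simp
  then show "\<exists>p. agree m (shift q c) (shift p u)" by blast
qed

lemma u_subshift: "u \<in> subshift"
  unfolding subshift_def by (auto intro: exI[of _ 0])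

lemma shift_u_subshift: "shift p u \<in> subshift"
  by (simp add: shift_subshift u_subshift)

lemma subshift_less: "c \<in> subshift \<Longrightarrow> c i < b"
  using u_less by (metis (mono_tags, lifting) agree_def subshiftE shift_def abs_ge_zero nat_0_le order_refl)

lemma shift_u_eq_iff [simp]: "shift p u = shift q u \<longleftrightarrow> p = q" "shift p u = u \<longleftrightarrow> p = 0"
proof -
  show 1: "shift p u = u \<longleftrightarrow> p = 0" for p using aperiodic by auto
  have "shift p u = shift q u \<longleftrightarrow> shift (p - q) u = u"
    by (metis shift_eq_iff shift_shift add.commute uminus_add_conv_diff)
  then show "shift p u = shift q u \<longleftrightarrow> p = q" using 1 by simp
qed

text \<open>For \<open>c = u\<close>, a central window of \<open>d\<close> occurs inside a larger
  central window of a suitable shift of \<open>u\<close>, and so recurs with bounded gaps. A general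
  \<open>c\<close> copies a stretch of \<open>u\<close> longer than such a gap, so the same
  \<open>R\<close> works for it.\<close>

lemma subshift_recurs:
  assumes c: "c \<in> subshift" and d: "d \<in> subshift"
  shows "\<exists>R. \<forall>p. \<exists>q. p \<le> q \<and> q \<le> p + R \<and> agree m (shift q c) d"
proof -
  obtain p1 where p1: "agree m d (shift p1 u)" using subshiftE[OF d] .
  obtain R where R: "\<And>p. \<exists>q. p \<le> q \<and> q \<le> p + R \<and> agree (m + nat \<bar>p1\<bar>) (shift q u) u"
    using recurrent unfolding uniformly_recurrent_def agree_def shift_def by (metis add.commute)
  have u: "\<exists>q. p \<le> q \<and> q \<le> p + R \<and> agree m (shift q u) d" for p
  proof -
    obtain q where q: "p - p1 \<le> q" "q \<le> p - p1 + R" "agree (m + nat \<bar>p1\<bar>) (shift q u) u"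
      using R by blast
    have "agree m (shift (p1 + q) u) (shift p1 u)"
      using agree_shift[OF q(3), of m p1] by simp
    then have "agree m (shift (p1 + q) u) d" using p1 agree_sym agree_trans by blast
    then show ?thesis using q by (intro exI[of _ "p1 + q"]) auto
  qed
  have "\<exists>q. p \<le> q \<and> q \<le> p + R \<and> agree m (shift q c) d" for p
  proof -
    obtain p2 where p2: "agree (nat (\<bar>p\<bar> + \<bar>R\<bar>) + m) c (shift p2 u)" using subshiftE[OF c] .
    obtain q where q: "p + p2 \<le> q" "q \<le> p + p2 + R" "agree m (shift q u) d" using u by blast
    have "agree m (shift (q - p2) c) (shift q u)"
      using agree_shift[OF p2, of m "q - p2"] q by simp
    then have "agree m (shift (q - p2) c) d" using q(3) agree_trans by blast
    then show ?thesis using q by (intro exI[of _ "q - p2"]) auto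
  qed
  then show ?thesis by blast
qed

lemma returns_after:
  assumes "c \<in> subshift" "d \<in> subshift"
  obtains q where "p \<le> q" "agree m (shift q c) d"
  using subshift_recurs[OF assms, of m] by (elim exE allE[of _ p]) blast

lemma returns_before:
  assumes "c \<in> subshift" "d \<in> subshift"
  obtains q where "q \<le> p" "agree m (shift q c) d"
proof -
  obtain R where R: "\<And>p. \<exists>q. p \<le> q \<and> q \<le> p + R \<and> agree m (shift q c) d"
    using subshift_recurs[OF assms] by blast
  then show ?thesis using that R[of "p - R"] by auto
qed

text \<open>The radius of the first disagreement with \<open>u\<close>, an inverse distance from the
  marked point. It is meaningful only for \<open>c \<noteq> u\<close>.\<close>

definition level :: "(int \<Rightarrow> nat) \<Rightarrow> nat" where
  "level c = (LEAST k. \<not> agree k c u)"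

text \<open>This is local constancy of \<open>level\<close> away from \<open>u\<close>: disagreement
  with \<open>u\<close> already shows within radius \<open>k\<close>, where \<open>c\<close> and
  \<open>d\<close> coincide.\<close>

lemma level_cong:
  assumes "agree k c d" "\<not> agree k d u"
  shows "c \<noteq> u" "level c = level d"
proof -
  have "\<not> agree k c u" using assms agree_sym agree_trans by blast
  then show "c \<noteq> u" by auto
  have iff: "agree j c u \<longleftrightarrow> agree j d u" if "j \<le> k" for j
    using agree_mono[OF assms(1) that] agree_sym agree_trans by blast
  show "level c = level d"
    unfolding level_def
  proof (rule Least_equality[OF _ ])
    show "\<not> agree (LEAST k. \<not> agree k d u) c u"
      using LeastI[of "\<lambda>k. \<not> agree k d u", OF assms(2)] Least_le[of "\<lambda>k. \<not> agree k d u", OF assms(2)] iff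
      by blast
    fix j assume "\<not> agree j c u"
    then show "(LEAST k. \<not> agree k d u) \<le> j"
      using Least_le[of "\<lambda>k. \<not> agree k d u"] iff assms(2) by (metis nat_le_linear order_trans)
  qed
qed

lemma level_not_agree: "c \<noteq> u \<Longrightarrow> \<not> agree (level c) c u"
  unfolding level_def using agree_all_imp_eq LeastI_ex[of "\<lambda>k. \<not> agree k c u"] by blast

lemma agree_below_level: "k < level c \<Longrightarrow> agree k c u"
  unfolding level_def using not_less_Least by blast

text \<open>For each of the finitely many shifts up to \<open>L\<close>, aperiodicity gives a
  position at which \<open>u\<close> differs from its shift. A window that sees all these positions
  excludes two visits near \<open>u\<close> that are so close in time. This sparsity keeps the
  fibres from adding entropy.\<close>

lemma return_gap:
  obtains k where "\<And>c p. \<lbrakk>agree k c u; agree k (shift p c) u; 0 < p\<rbrakk> \<Longrightarrow> int L < p"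
proof -
  have "\<exists>k. \<forall>c. \<not> (agree k c u \<and> agree k (shift (int p + 1) c) u)" for p
  proof -
    have "shift (int p + 1) u \<noteq> u" by simp
    then obtain i where i: "u (i + (int p + 1)) \<noteq> u i" unfolding shift_def by (metis ext)
    show ?thesis
    proof (intro exI allI notI)
      fix c assume a: "agree (nat \<bar>i\<bar> + p + 1) c u \<and> agree (nat \<bar>i\<bar> + p + 1) (shift (int p + 1) c) u"
      have "\<bar>i + (int p + 1)\<bar> \<le> int (nat \<bar>i\<bar> + p + 1)" "\<bar>i\<bar> \<le> int (nat \<bar>i\<bar> + p + 1)" by auto
      then have "c (i + (int p + 1)) = u (i + (int p + 1))" "c (i + (int p + 1)) = u i"
        using a unfolding agree_def shift_def by blast+
      then show False using i by simp
    qed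
  qed
  then obtain k where k: "\<And>p c. \<not> (agree (k p) c u \<and> agree (k p) (shift (int p + 1) c) u)" by metis
  define K where "K = Max (k ` {..L})"
  show thesis
  proof (rule that[of K], rule ccontr)
    fix c p assume a: "agree K c u" "agree K (shift p c) u" "0 < p" "\<not> int L < p"
    define p' where "p' = nat (p - 1)"
    have p': "p = int p' + 1" "p' \<le> L" using a by (auto simp: p'_def)
    then have "k p' \<le> K" by (simp add: K_def)
    then show False using k[of p' c] a agree_mono p' by blast
  qed
qed

definition levels :: "nat set" where
  "levels = {level (shift p u) | p. p > 0}"

text \<open>The forward orbit of \<open>u\<close> returns arbitrarily close to \<open>u\<close> but,
  by aperiodicity, never to \<open>u\<close> itself.\<close>

lemma infinite_levels: "infinite levels"
  unfolding infinite_nat_iff_unbounded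
proof
  fix m
  obtain q where q: "1 \<le> q" "agree m (shift q u) u" using returns_after[OF u_subshift u_subshift] .
  then have "\<not> agree (level (shift q u)) (shift q u) u" by (intro level_not_agree) simp
  then have "m < level (shift q u)" using q agree_mono not_le by blast
  then show "\<exists>n>m. n \<in> levels" using q unfolding levels_def by force
qed

text \<open>The function \<open>\<psi>\<close> of the introduction is \<open>\<lambda>c. spike (level c)\<close>. Only the levels in \<open>levels\<close> are attained, so
  the rational points of the hedgehog are enumerated along that set, each one infinitely often.\<close>

definition spike :: "nat \<Rightarrow> nat \<Rightarrow> real" where
  "spike k = (case prod_decode (fst (prod_decode (inv_into UNIV (enumerate levels) k))) of
     (i, a) \<Rightarrow> (case prod_decode a of (x, y) \<Rightarrow> spoke i (min 1 (real x / real (y + 1)))))"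

lemma spike_hedgehog: "spike k \<in> hedgehog"
  by (auto simp: spike_def split: prod.split intro!: spoke_hedgehog)

lemma spike_dense:
  assumes t: "0 \<le> t" "t \<le> 1" and \<delta>: "\<delta> > 0"
  obtains p where "p > 0" "m \<le> level (shift p u)"
    "\<And>j. \<bar>spike (level (shift p u)) j - spoke i t j\<bar> \<le> \<delta>"
proof -
  obtain y :: nat where y: "1 / \<delta> < real y" using reals_Archimedean2 by blast
  \<comment> \<open>Rounding \<open>t\<close> down to a fraction with denominator
    \<open>y + 1\<close> makes an error below \<open>\<delta>\<close>.\<close>
  define x where "x = nat \<lfloor>t * real (y + 1)\<rfloor>"
  have x: "real x \<le> t * real (y + 1)" "t * real (y + 1) < real x + 1"
    using t by (auto simp: x_def)
  have le: "real x / real (y + 1) \<le> t" using x by (simp add: field_simps)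
  have "t - real x / real (y + 1) = (t * real (y + 1) - real x) / real (y + 1)"
    by (simp add: diff_divide_distrib)
  also have "\<dots> \<le> 1 / real (y + 1)"
    using x by (intro divide_right_mono) auto
  also have "\<dots> \<le> \<delta>"
    using y \<delta> by (simp add: field_simps)
  finally have close: "t - real x / real (y + 1) \<le> \<delta>" .
  \<comment> \<open>The last component \<open>m\<close> is ignored by \<open>spike\<close>. It only
    pushes the index, and with it the level, up to at least \<open>m\<close>.\<close>
  define k where "k = enumerate levels (prod_encode (prod_encode (i, prod_encode (x, y)), m))"
  have "inj (enumerate levels)" using bij_enumerate[OF infinite_levels] bij_betw_def by blast
  then have sp: "spike k = spoke i (min 1 (real x / real (y + 1)))"
    by (simp add: spike_def k_def)
  have "m \<le> k" unfolding k_def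
    using le_enumerate[OF infinite_levels] le_prod_encode_2 order_trans by blast
  moreover have "k \<in> levels" unfolding k_def by (rule enumerate_in_set[OF infinite_levels])
  moreover have "\<bar>spike k j - spoke i t j\<bar> \<le> \<delta>" for j
    unfolding sp using le close t \<delta> by (auto simp: spoke_def)
  ultimately show thesis using that unfolding levels_def by blast
qed

end

section \<open>The compact extension and its minimal map\<close>

locale star_extension = recurrent_sequence +
  fixes N :: "nat \<Rightarrow> nat"
  assumes N_mono: "strict_mono N" and N_ge: "3 \<le> N 0"
begin

lemma N_le: "m \<le> n \<Longrightarrow> N m \<le> N n"
  using N_mono by (simp add: strict_mono_less_eq)

text \<open>By aperiodicity \<open>shift (int m) c = u\<close> holds for at most one
  \<open>m\<close>. So at most one fibre vector is free, and the fibre over \<open>c\<close> is a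
  point or a star with \<open>N m\<close> arms. This describes the closure explicitly.\<close>

definition adm :: "(int \<Rightarrow> nat) \<Rightarrow> (nat \<Rightarrow> nat \<Rightarrow> real) \<Rightarrow> bool" where
  "adm c y \<longleftrightarrow> (\<forall>m. y m \<in> star (N m) \<and>
     (shift (int m) c \<noteq> u \<longrightarrow> y m = trunc (N m) (spike (level (shift (int m) c)))))"

definition X :: "point set" where
  "X = {pt c y | c y. c \<in> subshift \<and> adm c y}"

text \<open>Fibre vectors move down one place and must lose the spokes not allowed there. Vector 0
  is forgotten, so the star over \<open>u\<close> collapses to a point and \<open>T\<close> is not
  injective.\<close>

definition T :: "point \<Rightarrow> point" where
  "T x = merge (\<lambda>i. x (base_ix (i + 1))) (\<lambda>m. trunc (N m) (\<lambda>j. x (fib_ix (Suc m) j)))"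

lemma pt_in_X: "pt c y \<in> X \<longleftrightarrow> c \<in> subshift \<and> adm c y"
  unfolding X_def by (auto simp: pt_eq_iff)

lemma XE:
  assumes "x \<in> X" obtains c y where "x = pt c y" "c \<in> subshift" "adm c y"
  using assms unfolding X_def by blast

lemma T_pt: "T (pt c y) = pt (shift 1 c) (\<lambda>m. trunc (N m) (y (Suc m)))"
  by (simp add: T_def shift_def)

lemma adm_star: "adm c y \<Longrightarrow> y m \<in> star (N m)"
  by (simp add: adm_def)

lemma T_X: "x \<in> X \<Longrightarrow> T x \<in> X"
proof (erule XE)
  fix c y assume x: "x = pt c y" and c: "c \<in> subshift" and y: "adm c y"
  have "adm (shift 1 c) (\<lambda>m. trunc (N m) (y (Suc m)))"
    unfolding adm_def
  proof (intro allI conjI impI)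
    fix m
    show "trunc (N m) (y (Suc m)) \<in> star (N m)"
      using adm_star[OF y] starD trunc_in_star by blast
    assume "shift (int m) (shift 1 c) \<noteq> u"
    then have "y (Suc m) = trunc (N (Suc m)) (spike (level (shift (int (Suc m)) c)))"
      using y unfolding adm_def by (simp add: add.commute)
    then show "trunc (N m) (y (Suc m)) = trunc (N m) (spike (level (shift (int m) (shift 1 c))))"
      using N_le[of m "Suc m"] by (simp add: add.commute min_def)
  qed
  then show ?thesis using c x by (simp add: T_pt pt_in_X shift_subshift)
qed

lemma funpow_T:
  assumes "adm c y"
  shows "(T ^^ n) (pt c y) = pt (shift (int n) c) (\<lambda>m. trunc (N m) (y (m + n)))"
proof (induction n)
  case 0
  then show ?case using adm_star[OF assms] starD(2) by simp
next
  case (Suc n)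
  have "min (N m) (N (Suc m)) = N m" for m using N_le[of m "Suc m"] by simp
  then show ?case using Suc by (simp add: T_pt)
qed

lemma funpow_T_X: "x \<in> X \<Longrightarrow> (T ^^ n) x \<in> X"
  by (induction n) (auto intro: T_X)

lemma funpow_TE:
  assumes "c \<in> subshift" "adm c y"
  obtains z where "(T ^^ n) (pt c y) = pt (shift (int n) c) z" "adm (shift (int n) c) z"
proof -
  have "(T ^^ n) (pt c y) \<in> X" using assms by (simp add: funpow_T_X pt_in_X)
  then show thesis using that unfolding funpow_T[OF assms(2)] pt_in_X by blast
qed

lemma continuous_on_T: "continuous_on S T"
proof (rule continuous_on_coordinatewise_then_product)
  fix n show "continuous_on S (\<lambda>x. T x n)"
  proof (cases n rule: ix_cases)
    case (1 i) then show ?thesis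
      unfolding T_def by (simp add: continuous_on_product_coordinates continuous_on_subset[OF continuous_on_product_coordinates])
  next
    case (2 m j) then show ?thesis
      unfolding T_def by (cases "j < N m") (simp_all add: trunc_def continuous_on_subset[OF continuous_on_product_coordinates])
  qed
qed

text \<open>Base coordinates are integers, hence eventually constant along a convergent sequence. If
  \<open>shift (int m) d \<noteq> u\<close>, the level and with it the prescribed fibre vector are
  eventually constant too; otherwise only closedness of the star is needed.\<close>

lemma closed_X: "closed X"
  unfolding closed_sequential_limits
proof clarify
  fix x l assume xX: "\<forall>n. x n \<in> X" and lim: "x \<longlonglongrightarrow> l"
  have "\<exists>cy. x n = pt (fst cy) (snd cy) \<and> fst cy \<in> subshift \<and> adm (fst cy) (snd cy)" for n
    using xX[rule_format, of n] by (elim XE) auto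
  then obtain cy where cy: "\<And>n. x n = pt (fst (cy n)) (snd (cy n)) \<and> fst (cy n) \<in> subshift \<and> adm (fst (cy n)) (snd (cy n))"
    using choice[of "\<lambda>n cy. x n = pt (fst cy) (snd cy) \<and> fst cy \<in> subshift \<and> adm (fst cy) (snd cy)"] by blast
  define c y where "c n = fst (cy n)" and "y n = snd (cy n)" for n
  have x: "\<And>n. x n = pt (c n) (y n)" and c: "\<And>n. c n \<in> subshift" and y: "\<And>n. adm (c n) (y n)"
    using cy by (auto simp: c_def y_def)
  have lim': "(\<lambda>n. x n i) \<longlonglongrightarrow> l i" for i using lim[unfolded tendsto_coordinatewise] by simp
  have "\<exists>k. l (base_ix i) = real k \<and> (\<forall>\<^sub>F n in sequentially. c n i = k)" for i
    using eventually_constant_nat[of "\<lambda>n. c n i"] lim'[of "base_ix i"] by (simp add: x)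
  then obtain d where d: "\<And>i. l (base_ix i) = real (d i)" "\<And>i. \<forall>\<^sub>F n in sequentially. c n i = d i"
    by metis
  define z where "z m j = l (fib_ix m j)" for m j
  have l: "l = pt d z" using merge_coordinates[of l] by (simp add: d(1) z_def[abs_def])
  have ylim: "(\<lambda>n. y n m j) \<longlonglongrightarrow> z m j" for m j using lim'[of "fib_ix m j"] by (simp add: x z_def)
  have ag: "\<forall>\<^sub>F n in sequentially. agree k (c n) d" for k
  proof -
    have "\<forall>\<^sub>F n in sequentially. \<forall>i\<in>{- int k..int k}. c n i = d i"
      using d(2) by (simp add: eventually_ball_finite)
    then show ?thesis by eventually_elim (auto simp: agree_def abs_le_iff)
  qed
  have "d \<in> subshift"
    unfolding subshift_def
  proof clarify
    fix m
    obtain n where n: "agree m (c n) d" using ag[of m] eventually_sequentially by auto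
    obtain p where "agree m (c n) (shift p u)" using subshiftE[OF c] .
    then show "\<exists>p. agree m d (shift p u)" using n agree_sym agree_trans by blast
  qed
  moreover have "adm d z"
    unfolding adm_def
  proof (intro allI conjI impI)
    fix m
    have ys: "y n m \<in> star (N m)" for n using y by (rule adm_star)
    have "0 \<le> z m j" "z m j \<le> 1" for j
      using star_bounds[OF ys] by (auto intro: LIMSEQ_le_const[OF ylim] LIMSEQ_le_const2[OF ylim])
    moreover have "z m i * z m j = 0" if "i \<noteq> j" for i j
    proof -
      have "y n m i * y n m j = 0" for n using ys[of n] that by (simp add: star_def hedgehog_def)
      then have "(\<lambda>n. 0) \<longlonglongrightarrow> z m i * z m j" using tendsto_mult[OF ylim ylim, of m i m j] by (simp only:)
      then show ?thesis by (metis LIMSEQ_const_iff)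
    qed
    moreover have "z m j = 0" if "\<not> j < N m" for j
    proof -
      have "y n m j = 0" for n using fun_cong[OF starD(2)[OF ys[of n]], of j] that by (simp add: trunc_def)
      then show ?thesis using ylim[of m j] by (simp add: LIMSEQ_const_iff)
    qed
    ultimately show "z m \<in> star (N m)"
      unfolding star_def hedgehog_def trunc_def by auto
    assume ne: "shift (int m) d \<noteq> u"
    let ?k = "level (shift (int m) d)"
    have "\<forall>\<^sub>F n in sequentially. y n m = trunc (N m) (spike ?k)"
      using ag[of "?k + m"]
    proof eventually_elim
      case (elim n)
      then have "agree ?k (shift (int m) (c n)) (shift (int m) d)" by (intro agree_shift) auto
      then have "shift (int m) (c n) \<noteq> u" "level (shift (int m) (c n)) = ?k"
        using level_cong level_not_agree[OF ne] by blast+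
      then show ?case using y[of n] unfolding adm_def by simp
    qed
    then have "(\<lambda>n. y n m j) \<longlonglongrightarrow> trunc (N m) (spike ?k) j" for j
      by (intro tendsto_eventually) (auto elim: eventually_mono)
    then show "z m = trunc (N m) (spike ?k)" using ylim LIMSEQ_unique by blast
  qed
  ultimately show "l \<in> X" using l by (simp add: pt_in_X)
qed

lemma compact_X: "compact X"
proof -
  have "X \<subseteq> {x. \<forall>n. x n \<in> {0..real b + 1}}"
  proof clarify
    fix x n assume "x \<in> X"
    then obtain c y where x: "x = pt c y" "c \<in> subshift" "adm c y" by (rule XE)
    show "x n \<in> {0..real b + 1}"
    proof (cases n rule: ix_cases)
      case (1 i) then show ?thesis using x subshift_less[OF x(2), of i] by auto
    next
      case (2 m j) then show ?thesis using x star_bounds[OF adm_star[OF x(3)], of m j] by auto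
    qed
  qed
  then show ?thesis using compact_product_intervals closed_X
    by (metis compact_Int_closed inf.absorb2)
qed

lemma fibre_determined:
  assumes z: "adm d z"
  obtains Q where "\<And>c y m. \<lbrakk>adm c y; agree Q c d; m \<le> q; shift (int m) d \<noteq> u\<rbrakk> \<Longrightarrow> y m = z m" "q \<le> Q"
proof -
  define k where "k m = level (shift (int m) d)" for m
  \<comment> \<open>The radius must still exceed every relevant level after a shift by
    \<open>m \<le> q\<close>.\<close>
  define Q where "Q = q + Max (k ` {..q})"
  have "y m = z m" if y: "adm c y" and a: "agree Q c d" and m: "m \<le> q" and ne: "shift (int m) d \<noteq> u" for c y m
  proof -
    have "k m \<le> Max (k ` {..q})" using m by simp
    then have "int (k m) + \<bar>int m\<bar> \<le> int Q" using m unfolding Q_def by linarith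
    then have "agree (k m) (shift (int m) c) (shift (int m) d)" by (rule agree_shift[OF a])
    then have "shift (int m) c \<noteq> u" "level (shift (int m) c) = level (shift (int m) d)"
      using level_cong level_not_agree[OF ne] unfolding k_def by blast+
    then show ?thesis using y z ne unfolding adm_def by metis
  qed
  then show thesis using that[of Q] by (simp add: Q_def)
qed

text \<open>For \<open>p > 0\<close> these are the fibre vectors of the only point over
  \<open>shift p u\<close>, whose forward orbit never meets \<open>u\<close>.\<close>

definition gen :: "int \<Rightarrow> nat \<Rightarrow> nat \<Rightarrow> real" where
  "gen p m = trunc (N m) (spike (level (shift (int m + p) u)))"

lemma adm_gen: "p > 0 \<Longrightarrow> adm (shift p u) (gen p)"
  by (auto simp: adm_def gen_def spike_hedgehog trunc_in_star)

lemma X_nonempty: "X \<noteq> {}"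
  using adm_gen[of 1] pt_in_X shift_u_subshift by fastforce

text \<open>If none of the first \<open>q + 1\<close> shifts of \<open>c\<close> is
  \<open>u\<close>, the relevant fibre vectors are locally constant and any return to
  \<open>c\<close> works. If \<open>shift (int M) c = u\<close>, the vector \<open>y M\<close> is
  free, and density of the spikes near \<open>u\<close> supplies an approximation of it.\<close>

lemma generic_approx:
  assumes c: "c \<in> subshift" and y: "adm c y" and \<delta>: "\<delta> > 0"
  obtains p where "p > 0" "agree q (shift p u) c" "\<And>m j. m \<le> q \<Longrightarrow> \<bar>gen p m j - y m j\<bar> \<le> \<delta>"
proof -
  obtain Q where Q: "\<And>c' y' m. \<lbrakk>adm c' y'; agree Q c' c; m \<le> q; shift (int m) c \<noteq> u\<rbrakk> \<Longrightarrow> y' m = y m" "q \<le> Q"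
    using fibre_determined[OF y] by metis
  show thesis
  proof (cases "\<exists>M\<le>q. shift (int M) c = u")
    case False
    obtain p where p: "1 \<le> p" "agree Q (shift p u) c" using returns_after[OF u_subshift c] .
    then have "gen p m = y m" if "m \<le> q" for m
      using Q(1)[OF adm_gen p(2) that] False that by simp
    then show thesis using that[of p] p agree_mono[OF p(2) Q(2)] \<delta> by simp
  next
    case True
    then obtain M where M: "M \<le> q" "shift (int M) c = u" by blast
    then have c_eq: "c = shift (- int M) u" using shift_eq_iff by blast
    obtain i t where it: "0 \<le> t" "t \<le> 1" "y M = spoke i t"
      using adm_star[OF y] starD(1) hedgehogE by metis
    \<comment> \<open>Agreement with \<open>u\<close> of radius \<open>Q + M\<close> leaves radius
      \<open>Q\<close> after moving back by \<open>M\<close>.\<close>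
    obtain p0 where p0: "p0 > 0" "Q + M + 1 \<le> level (shift p0 u)"
      "\<And>j. \<bar>spike (level (shift p0 u)) j - spoke i t j\<bar> \<le> \<delta>"
      using spike_dense[OF it(1,2) \<delta>] by metis
    define k where "k = level (shift p0 u)"
    have nk: "\<not> agree k (shift p0 u) u" unfolding k_def using p0 by (intro level_not_agree) simp
    \<comment> \<open>\<open>p0\<close> may be at most \<open>M\<close>, while
      \<open>p - int M\<close> has to be positive. Agreement up to the level \<open>k\<close>
      preserves the spike value.\<close>
    obtain p where p: "int M + 1 \<le> p" "agree k (shift p u) (shift p0 u)"
      using returns_after[OF u_subshift shift_u_subshift] .
    have lev: "level (shift p u) = k" using level_cong(2)[OF p(2) nk] k_def by simp
    have "agree (Q + M) (shift p u) u" by (rule agree_below_level) (use lev p0 k_def in simp)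
    then have "agree Q (shift (- int M) (shift p u)) (shift (- int M) u)" by (rule agree_shift) simp
    then have a: "agree Q (shift (p - int M) u) c" by (simp add: c_eq)
    have pos: "p - int M > 0" using p by simp
    have "\<bar>gen (p - int M) m j - y m j\<bar> \<le> \<delta>" if m: "m \<le> q" for m j
    proof (cases "m = M")
      case True
      have "y M j = trunc (N M) (spoke i t) j"
        using starD(2)[OF adm_star[OF y, of M]] it(3) by simp
      moreover have "gen (p - int M) M j = trunc (N M) (spike k) j" by (simp add: gen_def lev)
      ultimately show ?thesis using p0(3)[of j] \<delta> True by (simp add: trunc_def k_def)
    next
      case False
      then have "shift (int m) c \<noteq> u" by (simp add: c_eq)
      then have "gen (p - int M) m = y m" using Q(1)[OF adm_gen[OF pos] a m] by simp
      then show ?thesis using \<delta> by simp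
    qed
    then show thesis using that[of "p - int M"] pos agree_mono[OF a Q(2)] by blast
  qed
qed

text \<open>Only the points over the forward orbit of \<open>u\<close> have to be reached exactly: their fibres are
  singletons and they are dense.\<close>

lemma closureI_generic:
  assumes "\<And>p Q. p > 0 \<Longrightarrow> \<exists>d z. pt d z \<in> S \<and> adm d z \<and> agree Q d (shift p u)"
  shows "X \<subseteq> closure S"
proof
  fix x assume "x \<in> X"
  then obtain c y where x: "x = pt c y" "c \<in> subshift" "adm c y" by (rule XE)
  show "x \<in> closure S" unfolding x(1)
  proof (rule pt_in_closureI)
    fix q and \<delta> :: real assume "\<delta> > 0"
    then obtain p where p: "p > 0" "agree q (shift p u) c" "\<And>m j. m \<le> q \<Longrightarrow> \<bar>gen p m j - y m j\<bar> \<le> \<delta>"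
      using generic_approx[OF x(2,3)] by metis
    obtain Q where Q: "\<And>d z m. \<lbrakk>adm d z; agree Q d (shift p u); m \<le> q; shift (int m) (shift p u) \<noteq> u\<rbrakk> \<Longrightarrow> z m = gen p m" "q \<le> Q"
      using fibre_determined[OF adm_gen[OF p(1)]] by metis
    obtain d z where dz: "pt d z \<in> S" "adm d z" "agree Q d (shift p u)" using assms[OF p(1)] by blast
    have "z m = gen p m" if "m \<le> q" for m using Q(1)[OF dz(2,3) that] p(1) by simp
    moreover have "agree q d c" using agree_mono[OF dz(3) Q(2)] p(2) agree_trans by blast
    ultimately show "\<exists>d z. pt d z \<in> S \<and> agree q d c \<and> (\<forall>m\<le>q. \<forall>j. \<bar>z m j - y m j\<bar> \<le> \<delta>)"
      using dz(1) p(3) by (intro exI[of _ d] exI[of _ z]) simp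
  qed
qed

text \<open>By \<open>closureI_generic\<close> it is enough that the base of the orbit returns near
  each \<open>shift p u\<close>; nearby fibre values are then forced.\<close>

lemma minimal_T: "minimal_map T X"
  unfolding minimal_map_def
proof (intro conjI ballI)
  show "continuous_on X T" by (rule continuous_on_T)
  show "T ` X \<subseteq> X" using T_X by blast
  fix x assume "x \<in> X"
  then obtain c y where x: "x = pt c y" "c \<in> subshift" "adm c y" by (rule XE)
  show "X \<subseteq> closure {(T ^^ n) x |n. True}"
  proof (rule closureI_generic)
    fix p :: int and Q
    obtain q where q: "0 \<le> q" "agree Q (shift q c) (shift p u)"
      using returns_after[OF x(2) shift_u_subshift] .
    obtain z where z: "(T ^^ nat q) x = pt (shift (int (nat q)) c) z" "adm (shift (int (nat q)) c) z"
      using funpow_TE[OF x(2,3)] unfolding x(1) by metis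
    have "pt (shift q c) z \<in> {(T ^^ n) x |n. True}" using z(1) q(1) by (auto intro!: exI[of _ "nat q"])
    then show "\<exists>d z. pt d z \<in> {(T ^^ n) x |n. True} \<and> adm d z \<and> agree Q d (shift p u)"
      using z(2) q by auto
  qed
qed

end

section \<open>Rigidity\<close>

lemma card_components_homeomorphism:
  assumes "homeomorphism A B h g"
  shows "card (components B) = card (components A)"
proof -
  have B: "B = h ` A" and inj: "inj_on h A"
    using assms by (auto simp: homeomorphism_def inj_on_def) metis
  have "components B = image h ` components A"
    unfolding components_def using connected_component_set_homeomorphism[OF assms]
    by (simp add: B image_image)
  moreover have "inj_on (image h) (components A)"
    using inj in_components_subset by (meson inj_onI inj_on_image_eq_iff)
  ultimately show ?thesis by (simp add: card_image)
qed

text \<open>The number of pieces left when \<open>x\<close> is removed from its own component, a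
  topological invariant of \<open>x\<close> in \<open>S\<close>.\<close>

definition branch_number :: "'a::t1_space set \<Rightarrow> 'a \<Rightarrow> nat" where
  "branch_number S x = card (components (connected_component_set S x - {x}))"

lemma branch_number_homeomorphism:
  assumes h: "homeomorphism S S' h g" and x: "x \<in> S"
  shows "branch_number S' (h x) = branch_number S x"
proof -
  let ?A = "connected_component_set S x"
  have e: "connected_component_set S' (h x) = h ` ?A"
    by (rule connected_component_set_homeomorphism[OF h x])
  have sub: "?A \<subseteq> S" by (rule connected_component_subset)
  have inj: "inj_on h S" by (rule inj_on_inverseI[of _ g]) (simp add: homeomorphism_apply1[OF h])
  have "h ` (?A - {x}) = h ` ?A - {h x}"
    using inj_on_image_set_diff[OF inj, of ?A "{x}"] sub x by auto
  then have "homeomorphism (?A - {x}) (h ` ?A - {h x}) h g"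
    using sub by (intro homeomorphism_of_subsets[OF h, of _ "{}"]) auto
  then show ?thesis
    unfolding branch_number_def e by (rule card_components_homeomorphism)
qed

lemma card_components_Un_le_2:
  assumes "connected A" "connected B"
  shows "card (components (A \<union> B)) \<le> 2"
proof -
  let ?S = "A \<union> B"
  \<comment> \<open>For an empty piece the representative is arbitrary.\<close>
  obtain a b where a: "A = {} \<or> a \<in> A" and b: "B = {} \<or> b \<in> B" by blast
  have "components ?S \<subseteq> {connected_component_set ?S a, connected_component_set ?S b}"
  proof
    fix C assume "C \<in> components ?S"
    then obtain x where x: "x \<in> ?S" "C = connected_component_set ?S x" by (auto simp: components_iff)
    have "connected_component ?S x a" if "x \<in> A"
      unfolding connected_component_def using that a assms(1) by (intro exI[of _ A]) auto
    moreover have "connected_component ?S x b" if "x \<in> B"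
      unfolding connected_component_def using that b assms(2) by (intro exI[of _ B]) auto
    ultimately show "C \<in> {connected_component_set ?S a, connected_component_set ?S b}"
      using x connected_component_eq_eq by (metis UnE connected_component_eq insertI1 insertI2 mem_Collect_eq)
  qed
  then have "card (components ?S) \<le> card {connected_component_set ?S a, connected_component_set ?S b}"
    by (intro card_mono) auto
  also have "\<dots> \<le> 2" by (simp add: card_insert_if)
  finally show ?thesis .
qed

lemma continuous_on_coordinate [continuous_intros]:
  "continuous_on S (\<lambda>x :: 'i \<Rightarrow> 'b::topological_space. x i)"
  by (rule continuous_on_subset[OF continuous_on_product_coordinates]) simp

lemma continuous_on_spoke: "continuous_on S (spoke i)"
  unfolding spoke_def[abs_def]
proof (rule continuous_on_coordinatewise_then_product)
  fix j show "continuous_on S (\<lambda>t. if j = i then t else 0)"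
    by (cases "j = i") (auto intro: continuous_intros)
qed

lemma connected_spoke_image: "connected I \<Longrightarrow> connected (spoke i ` I)"
  by (intro connected_continuous_image continuous_on_spoke)

lemma spoke_eq_iff: "spoke i s = spoke j t \<longleftrightarrow> s = t \<and> (i = j \<or> t = 0)"
proof
  assume eq: "spoke i s = spoke j t"
  show "s = t \<and> (i = j \<or> t = 0)"
    using fun_cong[OF eq, of i] fun_cong[OF eq, of j] by (auto simp: spoke_def split: if_splits)
qed (auto simp: spoke_def)

lemma spoke_at [simp]: "spoke i t i = t"
  by (simp add: spoke_def)

lemma spoke_0: "spoke i 0 = (\<lambda>_. 0)"
  by (auto simp: spoke_def)

lemma zero_in_star: "(\<lambda>_. 0) \<in> star n"
  by (auto simp: star_def hedgehog_def trunc_def)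

lemma spoke_in_star: "i < n \<Longrightarrow> 0 \<le> t \<Longrightarrow> t \<le> 1 \<Longrightarrow> spoke i t \<in> star n"
  unfolding star_def using spoke_hedgehog by (auto simp: trunc_def spoke_def)

lemma starE:
  assumes "v \<in> star n" "v \<noteq> (\<lambda>_. 0)"
  obtains i t where "i < n" "0 < t" "t \<le> 1" "v = spoke i t"
proof -
  obtain i t where it: "0 \<le> t" "t \<le> 1" "v = spoke i t"
    using hedgehogE[OF starD(1)[OF assms(1)]] by metis
  have "t \<noteq> 0" using assms(2) it(3) spoke_0 by metis
  moreover have "i < n"
  proof (rule ccontr)
    assume "\<not> i < n"
    then have "v i = 0" using fun_cong[OF starD(2)[OF assms(1)], of i] by (simp add: trunc_def)
    then show False using it \<open>t \<noteq> 0\<close> by simp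
  qed
  ultimately show thesis using that[of i t] it by simp
qed

text \<open>For \<open>n = 0\<close> the star is the bare centre, while the union is empty.\<close>

lemma star_eq: "0 < n \<Longrightarrow> star n = (\<Union>i<n. spoke i ` {0..1})"
proof (intro equalityI subsetI)
  fix v assume "v \<in> star n" "0 < n"
  then show "v \<in> (\<Union>i<n. spoke i ` {0..1})"
  proof (cases "v = (\<lambda>_. 0)")
    case True
    then show ?thesis using \<open>0 < n\<close> spoke_0 by (intro UN_I[of 0] image_eqI[of _ _ 0]) auto
  next
    case False
    then obtain i t where "i < n" "0 < t" "t \<le> 1" "v = spoke i t" using starE[OF \<open>v \<in> star n\<close>] by metis
    then show ?thesis by (intro UN_I[of i] image_eqI[of _ _ t]) auto
  qed
qed (auto intro: spoke_in_star)

lemma connected_star: "0 < n \<Longrightarrow> connected (star n)"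
  unfolding star_eq
proof (rule connected_Union)
  assume "0 < n"
  have "(\<lambda>_. 0) \<in> spoke i ` {0..1}" for i using spoke_0[of i] by (intro image_eqI[of _ _ 0]) auto
  then show "(\<Inter>i<n. spoke i ` {0..1}) \<noteq> {}" by blast
qed (auto intro: connected_spoke_image)

text \<open>The components are the open legs. On the punctured star, positivity of coordinate
  \<open>i\<close> and positivity of some other coordinate are disjoint open conditions that cover
  it, so a connected set stays in one leg.\<close>

lemma card_components_star_minus_centre: "card (components (star n - {\<lambda>_. 0})) = n"
proof -
  let ?S = "star n - {\<lambda>_. 0}"
  let ?leg = "\<lambda>i. spoke i ` {0<..1}"
  have leg_sub: "?leg i \<subseteq> ?S" if "i < n" for i
    using that spoke_in_star by (auto simp: spoke_eq_iff simp flip: spoke_0[of i])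
  have cc: "connected_component_set ?S x = ?leg i" if i: "i < n" "x \<in> ?leg i" for i x
  proof (rule connected_component_unique)
    show "x \<in> ?leg i" "?leg i \<subseteq> ?S" using i leg_sub by auto
    show "connected (?leg i)" by (intro connected_spoke_image) auto
    fix A assume A: "x \<in> A" "A \<subseteq> ?S" "connected A"
    let ?U = "{v :: nat \<Rightarrow> real. 0 < v i}" and ?V = "\<Union>j\<in>-{i}. {v :: nat \<Rightarrow> real. 0 < v j}"
    have op: "open {v :: nat \<Rightarrow> real. 0 < v j}" for j
      by (intro open_Collect_less continuous_intros)
    have cover: "\<exists>j<n. \<exists>t. 0 < t \<and> t \<le> 1 \<and> v = spoke j t" if "v \<in> A" for v
      using starE[of v n] that A(2) by (metis Diff_iff singletonI subsetD)
    have "A \<inter> ?V = {}"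
    proof (rule ccontr)
      assume "A \<inter> ?V \<noteq> {}"
      moreover have "A \<inter> ?U \<noteq> {}" using A(1) i(2) by auto
      moreover have "A \<subseteq> ?U \<union> ?V"
      proof
        fix v assume "v \<in> A"
        then obtain j t where "0 < t" "v = spoke j t" using cover by blast
        then show "v \<in> ?U \<union> ?V" by (cases "j = i") (auto intro!: bexI[of _ j])
      qed
      moreover have "?U \<inter> ?V \<inter> A = {}"
      proof (rule ccontr)
        assume "?U \<inter> ?V \<inter> A \<noteq> {}"
        then obtain v j where v: "v \<in> A" "0 < v i" "0 < v j" "j \<noteq> i" by auto
        then obtain k t where "v = spoke k t" using cover by blast
        then show False using v by (auto simp: spoke_def split: if_splits)
      qed
      moreover have "open ?U" "open ?V" using op by (auto intro: open_UN)
      ultimately show False using connectedD[OF A(3), of ?U ?V] by blast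
    qed
    show "A \<subseteq> ?leg i"
    proof
      fix v assume "v \<in> A"
      then obtain j t where jt: "0 < t" "t \<le> 1" "v = spoke j t" using cover by blast
      then have "j \<noteq> i \<Longrightarrow> v \<in> ?V" by (auto intro!: bexI[of _ j])
      then have "j = i" using \<open>A \<inter> ?V = {}\<close> \<open>v \<in> A\<close> by blast
      then show "v \<in> ?leg i" using jt by auto
    qed
  qed
  have "components ?S = ?leg ` {..<n}"
  proof (intro equalityI subsetI)
    fix C assume "C \<in> components ?S"
    then obtain x where x: "x \<in> ?S" "C = connected_component_set ?S x" by (auto simp: components_iff)
    then obtain i t where it: "i < n" "0 < t" "t \<le> 1" "x = spoke i t" using starE[of x n] by auto
    then have "C = ?leg i" using x(2) cc[of i x] by auto
    then show "C \<in> ?leg ` {..<n}" using it by auto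
  next
    fix C assume "C \<in> ?leg ` {..<n}"
    then obtain i where i: "i < n" "C = ?leg i" by auto
    have mem: "spoke i 1 \<in> ?leg i" by auto
    then have "spoke i 1 \<in> ?S" using leg_sub[OF i(1)] by blast
    then show "C \<in> components ?S"
      unfolding components_iff i(2) using cc[OF i(1) mem] by blast
  qed
  moreover have "inj_on ?leg {..<n}"
  proof (rule inj_onI)
    fix i j assume "?leg i = ?leg j"
    moreover have "spoke i 1 \<in> ?leg i" by auto
    ultimately obtain t where "spoke i 1 = spoke j t" "0 < t" by auto
    then show "i = j" by (auto simp: spoke_eq_iff)
  qed
  ultimately show ?thesis by (simp add: card_image)
qed

text \<open>What remains is the outer end of one arm and the part containing the centre, both
  connected. At the tip of an arm the outer end is empty, so 2 is only an upper bound.\<close>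

lemma card_components_star_minus_noncentre:
  assumes v: "v \<in> star n" "v \<noteq> (\<lambda>_. 0)"
  shows "card (components (star n - {v})) \<le> 2"
proof -
  obtain i t where it: "i < n" "0 < t" "t \<le> 1" "v = spoke i t" using starE[OF v] by metis
  let ?A = "spoke i ` {t<..1}"
  let ?f = "\<lambda>j. spoke j ` (if j = i then {0..<t} else {0..1})"
  let ?B = "\<Union>j<n. ?f j"
  have "star n - {v} = ?A \<union> ?B"
  proof (intro equalityI subsetI)
    fix w assume w: "w \<in> star n - {v}"
    then obtain j s where js: "j < n" "0 \<le> s" "s \<le> 1" "w = spoke j s"
      using star_eq[of n] it by auto
    then have "j \<noteq> i \<or> s \<noteq> t" using w it by auto
    then consider "j \<noteq> i" | "j = i" "s < t" | "j = i" "t < s" by linarith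
    then show "w \<in> ?A \<union> ?B"
    proof cases
      case 1 then show ?thesis using js by (intro UnI2 UN_I[of j]) auto
    next
      case 2 then show ?thesis using js by (intro UnI2 UN_I[of j]) auto
    next
      case 3 then show ?thesis using js by auto
    qed
  next
    fix w assume "w \<in> ?A \<union> ?B"
    then show "w \<in> star n - {v}"
      using it by (auto simp: spoke_eq_iff intro!: spoke_in_star split: if_splits)
  qed
  moreover have "connected ?A" by (intro connected_spoke_image) auto
  moreover have "connected ?B"
  proof (rule connected_Union)
    have "(\<lambda>_. 0) \<in> ?f j" for j using spoke_0[of j] it by (intro image_eqI[of _ _ 0]) auto
    then show "(\<Inter>j<n. ?f j) \<noteq> {}" by blast
  qed (auto intro!: connected_spoke_image)
  ultimately show ?thesis by (simp add: card_components_Un_le_2)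
qed

section \<open>Components and branch points of the extension\<close>

context star_extension begin

text \<open>Parametrises the fibre over the \<open>M\<close>-th preimage of \<open>u\<close> in the
  subshift by its single free vector.\<close>

definition fibre_pt :: "nat \<Rightarrow> (nat \<Rightarrow> real) \<Rightarrow> point" where
  "fibre_pt M v = pt (shift (- int M) u)
     (\<lambda>m. if m = M then v else trunc (N m) (spike (level (shift (int m - int M) u))))"

lemma adm_over_preimage:
  assumes "adm (shift (- int M) u) y"
  shows "pt (shift (- int M) u) y = fibre_pt M (y M)" "y M \<in> star (N M)"
proof -
  show "y M \<in> star (N M)" using assms by (rule adm_star)
  have "y m = trunc (N m) (spike (level (shift (int m - int M) u)))" if "m \<noteq> M" for m
    using assms that unfolding adm_def by auto
  then show "pt (shift (- int M) u) y = fibre_pt M (y M)"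
    unfolding fibre_pt_def by (auto simp: pt_eq_iff)
qed

lemma fibre_pt_X: "v \<in> star (N M) \<Longrightarrow> fibre_pt M v \<in> X"
  unfolding fibre_pt_def pt_in_X
  by (auto simp: shift_u_subshift adm_def spike_hedgehog trunc_in_star)

lemma fibre_pt_coordinate [simp]: "fibre_pt M v (fib_ix M j) = v j"
  by (simp add: fibre_pt_def)

lemma fibre_pt_eq_iff: "fibre_pt M v = fibre_pt M' v' \<longleftrightarrow> M = M' \<and> v = v'"
proof
  assume eq: "fibre_pt M v = fibre_pt M' v'"
  then have M: "M = M'" unfolding fibre_pt_def pt_eq_iff by simp
  have "v j = v' j" for j using fun_cong[OF eq, of "fib_ix M j"] by (simp add: M)
  then show "M = M' \<and> v = v'" using M by blast
qed simp

lemma continuous_on_fibre_pt: "continuous_on S (fibre_pt M)"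
proof (rule continuous_on_coordinatewise_then_product)
  fix n show "continuous_on S (\<lambda>v. fibre_pt M v n)"
  proof (cases n rule: ix_cases)
    case (2 m j) then show ?thesis by (cases "m = M") (simp_all add: fibre_pt_def continuous_on_coordinate)
  qed (simp add: fibre_pt_def)
qed

lemma homeomorphism_fibre_pt:
  "homeomorphism A (fibre_pt M ` A) (fibre_pt M) (\<lambda>x j. x (fib_ix M j))"
  unfolding homeomorphism_def
proof (intro conjI ballI continuous_on_fibre_pt)
  show "continuous_on (fibre_pt M ` A) (\<lambda>x j. x (fib_ix M j))"
    by (rule continuous_on_coordinatewise_then_product) (rule continuous_on_coordinate)
qed (auto simp: image_image)

text \<open>On \<open>X\<close> base coordinates take values in the natural numbers, so each of them
  is constant on a connected set.\<close>

lemma connected_same_base: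
  assumes S: "connected S" "S \<subseteq> X" and mem: "pt c y \<in> S" "pt d z \<in> S"
  shows "c = d"
proof
  fix i
  let ?f = "\<lambda>x :: point. x (base_ix i)"
  have "?f constant_on S"
  proof (rule continuous_discrete_range_constant[OF S(1) continuous_on_coordinate])
    fix x assume "x \<in> S"
    then have "x \<in> X" using S(2) by blast
    then obtain c y where x: "x = pt c y" "c \<in> subshift" "adm c y" by (rule XE)
    show "\<exists>e>0. \<forall>y. y \<in> S \<and> ?f y \<noteq> ?f x \<longrightarrow> e \<le> norm (?f y - ?f x)"
    proof (intro exI[of _ 1] conjI allI impI)
      fix x' assume x': "x' \<in> S \<and> ?f x' \<noteq> ?f x"
      then have "x' \<in> X" using S(2) by blast
      then obtain d z where "x' = pt d z" "d \<in> subshift" "adm d z" by (rule XE)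
      then have "real (d i) - real (c i) = of_int (int (d i) - int (c i))" "int (d i) - int (c i) \<noteq> 0"
        using x x' by auto
      then have "1 \<le> \<bar>real (d i) - real (c i)\<bar>" by linarith
      then show "1 \<le> norm (?f x' - ?f x)" using x \<open>x' = pt d z\<close> by simp
    qed simp
  qed
  then show "c i = d i" using mem unfolding constant_on_def by (metis merge_simps(1) of_nat_eq_iff)
qed

lemma component_over_preimage:
  assumes v: "v \<in> star (N M)"
  shows "connected_component_set X (fibre_pt M v) = fibre_pt M ` star (N M)"
proof (rule connected_component_unique)
  have "0 < N M" using N_ge N_le[of 0 M] by simp
  then show "connected (fibre_pt M ` star (N M))"
    by (intro connected_continuous_image continuous_on_fibre_pt connected_star)
  show "fibre_pt M v \<in> fibre_pt M ` star (N M)" using v by simp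
  show "fibre_pt M ` star (N M) \<subseteq> X" using fibre_pt_X by blast
  fix A assume A: "fibre_pt M v \<in> A" "A \<subseteq> X" "connected A"
  show "A \<subseteq> fibre_pt M ` star (N M)"
  proof
    fix x assume x: "x \<in> A"
    then have "x \<in> X" using A(2) by blast
    then obtain d z where dz: "x = pt d z" "d \<in> subshift" "adm d z" by (rule XE)
    have "d = shift (- int M) u"
      using connected_same_base[OF A(3,2)] x A(1) unfolding dz(1) fibre_pt_def by blast
    then show "x \<in> fibre_pt M ` star (N M)" using adm_over_preimage[of M z] dz by auto
  qed
qed

lemma component_minus_point:
  assumes v: "v \<in> star (N M)"
  shows "branch_number X (fibre_pt M v) = card (components (star (N M) - {v}))"
proof -
  have "fibre_pt M ` (star (N M) - {v}) = fibre_pt M ` star (N M) - {fibre_pt M v}"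
    by (auto simp: fibre_pt_eq_iff)
  then show ?thesis
    unfolding branch_number_def component_over_preimage[OF v]
    using card_components_homeomorphism[OF homeomorphism_fibre_pt[of "star (N M) - {v}" M]] by simp
qed

abbreviation centre :: "nat \<Rightarrow> point" where
  "centre M \<equiv> fibre_pt M (\<lambda>_. 0)"

lemma centre_X: "centre M \<in> X"
  by (intro fibre_pt_X zero_in_star)

lemma branch_number_centre: "branch_number X (centre M) = N M"
  by (simp add: component_minus_point zero_in_star card_components_star_minus_centre)

text \<open>Outside the stars the component is a single point and the branch number is 0; on a star,
  a noncentral point has branch number at most 2.\<close>

lemma branch_point_is_centre:
  assumes x: "x \<in> X" and br: "3 \<le> branch_number X x"
  obtains M where "x = centre M"
proof -
  obtain c y where cy: "x = pt c y" "c \<in> subshift" "adm c y" using x by (rule XE)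
  show thesis
  proof (cases "\<exists>M. shift (int M) c = u")
    case True
    then obtain M where c: "c = shift (- int M) u" using shift_eq_iff by blast
    have xf: "x = fibre_pt M (y M)" "y M \<in> star (N M)"
      using adm_over_preimage[of M y] cy(1,3) c by auto
    have "y M = (\<lambda>_. 0)"
    proof (rule ccontr)
      assume "y M \<noteq> (\<lambda>_. 0)"
      then have "branch_number X x \<le> 2"
        using card_components_star_minus_noncentre[OF xf(2)] component_minus_point[OF xf(2)] xf(1) by simp
      then show False using br by simp
    qed
    then show thesis using that xf(1) by simp
  next
    case False
    have "connected_component_set X x = {x}"
    proof (rule connected_component_unique)
      fix A assume A: "x \<in> A" "A \<subseteq> X" "connected A"
      show "A \<subseteq> {x}"
      proof
        fix x' assume x': "x' \<in> A"
        then have "x' \<in> X" using A(2) by blast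
        then obtain d z where dz: "x' = pt d z" "d \<in> subshift" "adm d z" by (rule XE)
        have "d = c" using connected_same_base[OF A(3,2)] A(1) x' unfolding dz(1) cy(1) by blast
        moreover have "z = y" using dz(3) cy(3) False unfolding adm_def \<open>d = c\<close> by (auto intro!: ext)
        ultimately show "x' \<in> {x}" using dz(1) cy(1) by simp
      qed
    qed (use x in auto)
    then have "branch_number X x = 0" by (simp add: branch_number_def)
    then show thesis using br by simp
  qed
qed

text \<open>The threshold 3 removes all values that come from points other than centres, so the
  range of \<open>N\<close> can be read off from the topology.\<close>

lemma branch_numbers: "{n. 3 \<le> n \<and> (\<exists>x\<in>X. branch_number X x = n)} = range N"
proof (intro equalityI subsetI)
  fix n assume "n \<in> {n. 3 \<le> n \<and> (\<exists>x\<in>X. branch_number X x = n)}"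
  then obtain x where x: "x \<in> X" "3 \<le> branch_number X x" "n = branch_number X x" by auto
  obtain M where "x = centre M" using branch_point_is_centre[OF x(1,2)] .
  then show "n \<in> range N" using x(3) branch_number_centre by simp
next
  fix n assume "n \<in> range N"
  then obtain M where "n = N M" by blast
  moreover have "3 \<le> N M" using N_ge N_le[of 0 M] by simp
  ultimately show "n \<in> {n. 3 \<le> n \<and> (\<exists>x\<in>X. branch_number X x = n)}"
    using branch_number_centre centre_X by blast
qed

text \<open>The centres lie over the backward orbit of \<open>u\<close>, which by recurrence in
  negative time comes near every \<open>shift p u\<close>.\<close>

lemma centres_dense: "X \<subseteq> closure (range centre)"
proof (rule closureI_generic)
  fix p :: int and Q
  obtain q where q: "q \<le> 0" "agree Q (shift q u) (shift p u)"
    using returns_before[OF u_subshift shift_u_subshift] .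
  define M where "M = nat (- q)"
  have M: "q = - int M" using q by (simp add: M_def)
  obtain z where z: "centre M = pt (shift q u) z" unfolding fibre_pt_def M by blast
  then have "adm (shift q u) z" using centre_X[of M] by (simp add: pt_in_X)
  then show "\<exists>d z. pt d z \<in> range centre \<and> adm d z \<and> agree Q d (shift p u)"
    using z q(2) by (metis rangeI)
qed

text \<open>A homeomorphism preserves branch numbers. Those of the centres are at least 3 and
  pairwise different, so every centre is fixed; density and continuity do the rest.\<close>

lemma degenerate_X: "degenerate_homeo_group X"
  unfolding degenerate_homeo_group_def
proof (intro allI impI ballI)
  fix h g x assume h: "homeomorphism X X h g" and x: "x \<in> X"
  have fixed: "h (centre M) = centre M" for M
  proof -
    have "h (centre M) \<in> X" using h centre_X unfolding homeomorphism_def by blast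
    moreover have br: "branch_number X (h (centre M)) = N M"
      using branch_number_homeomorphism[OF h centre_X] branch_number_centre by simp
    moreover have "3 \<le> N M" using N_ge N_le[of 0 M] by simp
    ultimately obtain M' where M': "h (centre M) = centre M'" using branch_point_is_centre by metis
    then have "N M' = N M" using br branch_number_centre by simp
    then show ?thesis using M' N_mono by (simp add: strict_mono_eq)
  qed
  obtain s where s: "\<And>n. s n \<in> range centre" "s \<longlonglongrightarrow> x"
    using centres_dense x closure_sequential[of x "range centre"] by blast
  have sX: "s n \<in> X" for n using s(1)[of n] centre_X by auto
  have "continuous_on X h" using h by (simp add: homeomorphism_def)
  then have "(\<lambda>n. h (s n)) \<longlonglongrightarrow> h x"
    using s(2) sX x unfolding continuous_on_sequentially by (auto simp: o_def)
  moreover have "h (s n) = s n" for n using s(1)[of n] fixed by auto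
  ultimately show "h x = x" using s(2) LIMSEQ_unique by simp
qed

end

lemma branch_numbers_homeomorphic:
  assumes "S homeomorphic S'"
  shows "(\<exists>x\<in>S. branch_number S x = n) \<longleftrightarrow> (\<exists>x\<in>S'. branch_number S' x = n)"
proof -
  obtain h g where h: "homeomorphism S S' h g" using assms homeomorphic_def by blast
  then have "h ` S = S'" by (simp add: homeomorphism_def)
  then show ?thesis using branch_number_homeomorphism[OF h] by (metis imageE imageI)
qed

section \<open>Entropy\<close>

lemma max_separated_le:
  assumes "\<And>E. separated_set T X n e E \<Longrightarrow> card E \<le> B"
  shows "max_separated T X n e \<le> B"
  unfolding max_separated_def
proof (rule cSup_least)
  show "{card E |E. separated_set T X n e E} \<noteq> {}"
    by (auto simp: separated_set_def intro!: exI[of _ "{}"])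
qed (use assms in auto)

text \<open>A uniform bound \<open>B\<close> is required because \<open>Sup\<close> of an unbounded
  set of naturals carries no information.\<close>

lemma max_separated_ge:
  assumes "\<And>E. separated_set T X n e E \<Longrightarrow> card E \<le> B" "separated_set T X n e E"
  shows "card E \<le> max_separated T X n e"
  unfolding max_separated_def
  by (rule cSup_upper) (use assms in \<open>auto simp: bdd_above_def intro!: exI[of _ B]\<close>)

lemma nat_floor_eq_imp_close:
  fixes \<delta> :: real
  assumes "\<delta> > 0" "0 \<le> a" "0 \<le> b" "nat \<lfloor>a / \<delta>\<rfloor> = nat \<lfloor>b / \<delta>\<rfloor>"
  shows "\<bar>a - b\<bar> \<le> \<delta>"
proof -
  have "0 \<le> \<lfloor>a / \<delta>\<rfloor>" "0 \<le> \<lfloor>b / \<delta>\<rfloor>" using assms by auto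
  then have "\<lfloor>a / \<delta>\<rfloor> = \<lfloor>b / \<delta>\<rfloor>" using assms(4) by linarith
  then have "\<bar>a / \<delta> - b / \<delta>\<bar> \<le> 1" by linarith
  then show ?thesis using assms(1) by (simp add: diff_divide_distrib[symmetric] abs_divide field_simps)
qed

lemma card_sparse_le:
  fixes V :: "nat set"
  assumes "\<And>m n. m \<in> V \<Longrightarrow> n \<in> V \<Longrightarrow> m < n \<Longrightarrow> m + L \<le> n" and "V \<subseteq> {..<K}" and "1 \<le> L"
  shows "card V \<le> K div L + 1"
proof -
  have "inj_on (\<lambda>m. m div L) V"
  proof (rule linorder_inj_onI')
    fix i j assume "i \<in> V" "j \<in> V" "i < j"
    then have "i + L \<le> j" using assms(1) by blast
    then have "(i + L) div L \<le> j div L" by (rule div_le_mono)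
    then show "i div L \<noteq> j div L" using assms(3) by simp
  qed
  moreover have "(\<lambda>m. m div L) ` V \<subseteq> {..K div L}"
    using assms(2) by (auto intro!: div_le_mono)
  ultimately have "card V \<le> card {..K div L}" by (intro card_inj_on_le) auto
  then show ?thesis by simp
qed

context recurrent_sequence begin

definition language :: "nat \<Rightarrow> nat list set" where
  "language n = range (\<lambda>p. window u p n)"

lemma card_language: "card (language n) = complexity u n"
  by (simp add: language_def complexity_def)

lemma finite_language: "finite (language n)"
proof (rule finite_subset)
  show "language n \<subseteq> {xs. set xs \<subseteq> {..<b} \<and> length xs = n}"
    using u_less by (auto simp: language_def window_def)
qed (simp add: finite_lists_length_eq)

lemma window_language:
  assumes "c \<in> subshift"
  shows "window c p n \<in> language n"
proof -
  obtain p' where "agree (nat \<bar>p\<bar> + n) c (shift p' u)" using subshiftE[OF assms] .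
  then have "window c p n = window u (p + p') n"
    unfolding window_eq_iff agree_def shift_def by (auto simp: algebra_simps)
  then show ?thesis by (auto simp: language_def)
qed

end

context star_extension begin

text \<open>A point is coded by a base window and by rounded fibre vectors at the times when its
  orbit is near \<open>u\<close>; at all other times the window determines the fibre vector. Since
  \<open>D\<close> and \<open>q\<close> are fixed before \<open>L\<close>, a large \<open>L\<close>
  makes the growth rate of the second factor as small as desired.\<close>

lemma separated_card_bound:
  assumes e: "e > 0"
  obtains D q where "1 \<le> D"
    "\<forall>L\<ge>1. \<exists>Q. \<forall>n E. separated_set T X n e E \<longrightarrow>
       card E \<le> complexity u (n + Q) * D ^ ((n + q) div L + 1)"
proof -
  obtain q \<delta> where \<delta>: "\<delta> > 0" and close: "\<And>c y d z. agree q c d \<Longrightarrow>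
      (\<forall>m\<le>q. \<forall>j. \<bar>y m j - z m j\<bar> \<le> \<delta>) \<Longrightarrow> dist (pt c y) (pt d z) < e"
    using pt_close[OF e] by blast
  \<comment> \<open>The unit interval is cut into cells of width \<open>\<delta>\<close>. Only the
    first \<open>N q\<close> coordinates are recorded, because the metric estimate looks at vectors
    \<open>m \<le> q\<close> truncated to \<open>N m\<close>.\<close>
  define D0 where "D0 = nat \<lfloor>1 / \<delta>\<rfloor>"
  define Dset where "Dset = PiE {..<N q} (\<lambda>_. {..D0})"
  define quant where "quant v = restrict (\<lambda>j. nat \<lfloor>v j / \<delta>\<rfloor>) {..<N q}" for v :: "nat \<Rightarrow> real"
  define D where "D = card Dset"
  have finD: "finite Dset" by (simp add: Dset_def finite_PiE)
  have D: "D = (D0 + 1) ^ N q" by (simp add: D_def Dset_def card_PiE)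
  have quant_in: "quant v \<in> Dset" if "v \<in> star n" for v n
    using star_bounds[OF that] \<delta>
    by (auto simp: quant_def Dset_def D0_def intro!: nat_mono floor_mono divide_right_mono)
  have quant_eq: "\<bar>v j - w j\<bar> \<le> \<delta>" if "v \<in> star n" "w \<in> star n'" "quant v = quant w" "j < N q" for v w n n' j
  proof (rule nat_floor_eq_imp_close[OF \<delta>])
    show "nat \<lfloor>v j / \<delta>\<rfloor> = nat \<lfloor>w j / \<delta>\<rfloor>"
      using fun_cong[OF that(3), of j] that(4) by (simp add: quant_def)
  qed (use star_bounds that in auto)
  have bound: "\<exists>Q. \<forall>n E. separated_set T X n e E \<longrightarrow>
       card E \<le> complexity u (n + Q) * D ^ ((n + q) div L + 1)" if L: "1 \<le> L" for L
  proof -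
    obtain k where k: "\<And>c p. \<lbrakk>agree k c u; agree k (shift p c) u; 0 < p\<rbrakk> \<Longrightarrow> int L < p"
      using return_gap by metis
    \<comment> \<open>Radius \<open>P\<close> serves both the closeness test of radius
      \<open>q\<close> and the detection of visits of radius \<open>k\<close>. The window from
      \<open>-P\<close> to \<open>n + q + P\<close> has length \<open>n + Q\<close> and contains
      this radius around every time up to \<open>n + q\<close>.\<close>
    define P where "P = q + k"
    define Q where "Q = 2 * P + q + 1"
    have "card E \<le> complexity u (n + Q) * D ^ ((n + q) div L + 1)"
      if sep: "separated_set T X n e E" for n E
    proof -
      have EX: "E \<subseteq> X" using sep by (simp add: separated_set_def)
      define base where "base x i = nat \<lfloor>x (base_ix i)\<rfloor>" for x :: point and i
      define fib where "fib x m j = x (fib_ix m j)" for x :: point and m j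
      have parts: "base (pt c y) = c" "fib (pt c y) = y" for c y
        by (simp_all add: base_def fib_def fun_eq_iff)
      define visits where "visits c = {m. m < n + q \<and> agree k (shift (int m) c) u}" for c
      define win where "win c = map (\<lambda>i. c (int i - int P)) [0..<n + Q]" for c :: "int \<Rightarrow> nat"
      have win_window: "win c = window c (- int P) (n + Q)" for c
        by (simp add: win_def window_def)
      have win_agree: "agree m (shift (int p) c) (shift (int p) d)"
        if eq: "win c = win d" and m: "m \<le> P" and p: "p \<le> n + q" for c d m p
        unfolding agree_def shift_def
      proof (intro allI impI)
        fix i :: int assume i: "\<bar>i\<bar> \<le> int m"
        define a where "a = nat (i + int p + int P)"
        have a: "a < n + Q" "i + int p = int a - int P" using i m p by (auto simp: a_def Q_def)
        then have "win c ! a = win d ! a" using eq by simp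
        then show "c (i + int p) = d (i + int p)" using a by (simp add: win_def del: upt_Suc)
      qed
      have visits_cong: "visits c = visits d" if eq: "win c = win d" for c d
      proof -
        have "agree k (shift (int m) c) u \<longleftrightarrow> agree k (shift (int m) d) u" if "m < n + q" for m
          using win_agree[OF eq, of k m] that agree_sym agree_trans unfolding P_def
          by (metis le_add2 less_imp_le)
        then show ?thesis unfolding visits_def by blast
      qed
      have card_visits: "card (visits c) \<le> (n + q) div L + 1" for c
      proof (rule card_sparse_le[OF _ _ L])
        fix m m' assume m: "m \<in> visits c" "m' \<in> visits c" "m < m'"
        have "int L < int m' - int m"
          by (rule k[of "shift (int m) c"]) (use m in \<open>auto simp: visits_def\<close>)
        then show "m + L \<le> m'" by simp
      qed (auto simp: visits_def)
      \<comment> \<open>The visit times depend on the window only, so any sequence with that window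
        may be chosen.\<close>
      define vis where "vis w = visits (SOME c. win c = w)" for w
      have vis_win: "vis (win c) = visits c" for c
        unfolding vis_def by (rule visits_cong) (rule someI[of "\<lambda>d. win d = win c"], simp)
      define code where "code x = (win (base x),
         restrict (\<lambda>m. if m \<in> visits (base x) then quant (fib x m) else undefined) {..<n + q})" for x
      \<comment> \<open>Times without a visit carry the single value \<open>undefined\<close> and
        contribute a factor 1 to the count.\<close>
      define codes where "codes = (SIGMA w:language (n + Q).
         PiE {..<n + q} (\<lambda>m. if m \<in> vis w then Dset else {undefined}))"
      have "inj_on code E"
      proof (rule inj_onI, rule ccontr)
        fix x x' assume x: "x \<in> E" "x' \<in> E" "code x = code x'" "x \<noteq> x'"
        have "x \<in> X" "x' \<in> X" using x EX by auto
        obtain c y where cy: "x = pt c y" "c \<in> subshift" "adm c y" using \<open>x \<in> X\<close> by (rule XE)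
        obtain d z where dz: "x' = pt d z" "d \<in> subshift" "adm d z" using \<open>x' \<in> X\<close> by (rule XE)
        obtain i where i: "i < n" "dist ((T ^^ i) x) ((T ^^ i) x') > e"
          using sep x unfolding separated_set_def by blast
        have w: "win c = win d" using x(3) by (simp add: code_def cy dz parts)
        have qeq: "quant (y m) = quant (z m)" if "m < n + q" "m \<in> visits c" for m
        proof -
          have "snd (code x) m = snd (code x') m" using x(3) by simp
          then show ?thesis using that visits_cong[OF w] by (simp add: code_def cy dz parts)
        qed
        have "dist ((T ^^ i) x) ((T ^^ i) x') < e"
          unfolding cy(1) dz(1) funpow_T[OF cy(3)] funpow_T[OF dz(3)]
        proof (rule close)
          show "agree q (shift (int i) c) (shift (int i) d)"
            by (rule win_agree[OF w]) (use i in \<open>auto simp: P_def\<close>)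
          show "\<forall>m\<le>q. \<forall>j. \<bar>trunc (N m) (y (m + i)) j - trunc (N m) (z (m + i)) j\<bar> \<le> \<delta>"
          proof (intro allI impI)
            fix m j assume m: "m \<le> q"
            then have mi: "m + i < n + q" using i by simp
            show "\<bar>trunc (N m) (y (m + i)) j - trunc (N m) (z (m + i)) j\<bar> \<le> \<delta>"
            proof (cases "j < N m")
              case True
              then have j: "j < N q" using N_le[OF m] by simp
              have "\<bar>y (m + i) j - z (m + i) j\<bar> \<le> \<delta>"
              proof (cases "m + i \<in> visits c")
                case v: True
                show ?thesis by (rule quant_eq[OF adm_star[OF cy(3)] adm_star[OF dz(3)] qeq[OF mi v] j])
              next
                case False
                have "\<not> agree k (shift (int (m + i)) c) u"
                  using False mi by (simp add: visits_def)
                moreover have "agree k (shift (int (m + i)) d) (shift (int (m + i)) c)"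
                  by (rule win_agree) (use w mi in \<open>auto simp: P_def\<close>)
                ultimately have "shift (int (m + i)) d \<noteq> u" "shift (int (m + i)) c \<noteq> u"
                  "level (shift (int (m + i)) d) = level (shift (int (m + i)) c)"
                  using level_cong[of k "shift (int (m + i)) d" "shift (int (m + i)) c"] by auto
                then have "y (m + i) = z (m + i)" using cy(3) dz(3) unfolding adm_def by metis
                then show ?thesis using \<delta> by simp
              qed
              then show ?thesis using True by (simp add: trunc_def)
            next
              case False then show ?thesis using \<delta> by (simp add: trunc_def)
            qed
          qed
        qed
        then show False using i by simp
      qed
      moreover have "code ` E \<subseteq> codes"
      proof (rule image_subsetI)
        fix x assume "x \<in> E"
        then have "x \<in> X" using EX by blast
        then obtain c y where cy: "x = pt c y" "c \<in> subshift" "adm c y" by (rule XE)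
        have "win c \<in> language (n + Q)" unfolding win_window by (rule window_language[OF cy(2)])
        then show "code x \<in> codes"
          using quant_in[OF adm_star[OF cy(3)]] by (auto simp: code_def codes_def cy parts vis_win)
      qed
      moreover have fin: "finite (PiE {..<n + q} (\<lambda>m. if m \<in> vis w then Dset else {undefined}))" for w
        by (rule finite_PiE) (use finD in auto)
      then have "finite codes" unfolding codes_def using finite_language by blast
      ultimately have "card E \<le> card codes" by (intro card_inj_on_le)
      also have "card codes = (\<Sum>w\<in>language (n + Q). card (PiE {..<n + q} (\<lambda>m. if m \<in> vis w then Dset else {undefined})))"
        unfolding codes_def using finite_language fin by (intro card_SigmaI) auto
      also have "\<dots> \<le> (\<Sum>w\<in>language (n + Q). D ^ ((n + q) div L + 1))"
      proof (rule sum_mono)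
        fix w
        have sub: "vis w \<subseteq> {..<n + q}" by (auto simp: vis_def visits_def)
        have "card (PiE {..<n + q} (\<lambda>m. if m \<in> vis w then Dset else {undefined}))
            = (\<Prod>m<n + q. if m \<in> vis w then D else 1)"
          by (simp add: card_PiE D_def if_distrib cong: if_cong)
        also have "\<dots> = D ^ card (vis w)"
          using sub by (simp add: prod.If_cases Int_absorb1)
        also have "\<dots> \<le> D ^ ((n + q) div L + 1)"
          using card_visits by (intro power_increasing) (auto simp: vis_def D)
        finally show "card (PiE {..<n + q} (\<lambda>m. if m \<in> vis w then Dset else {undefined})) \<le> D ^ ((n + q) div L + 1)" .
      qed
      also have "\<dots> = complexity u (n + Q) * D ^ ((n + q) div L + 1)" by (simp add: card_language)
      finally show ?thesis .
    qed
    then show ?thesis by blast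
  qed
  show thesis by (rule that[of D q]) (use bound in \<open>auto simp: D\<close>)
qed

lemma entropy_le:
  assumes r: "r > 0" and growth: "\<forall>\<eta>>0. \<forall>\<^sub>F n in sequentially. real (complexity u n) \<le> exp ((r + \<eta>) * real n)"
    and e: "e > 0"
  shows "limsup (\<lambda>n. ereal (ln (real (max_separated T X n e)) / real n)) \<le> ereal r"
proof (rule ereal_le_epsilon2)
  fix \<eta> :: real assume \<eta>: "0 < \<eta>"
  obtain D q where D: "1 \<le> D" and bound: "\<forall>L\<ge>1. \<exists>Q. \<forall>n E. separated_set T X n e E \<longrightarrow>
       card E \<le> complexity u (n + Q) * D ^ ((n + q) div L + 1)"
    by (rule separated_card_bound[OF e])
  define l where "l = ln (real D)"
  have l: "0 \<le> l" using D by (simp add: l_def)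
  \<comment> \<open>This makes the growth rate of the fibre factor at most a quarter of
    \<open>\<eta>\<close>; the complexity takes another quarter, and the half that is left absorbs
    the constant \<open>K\<close>.\<close>
  obtain L0 :: nat where "4 * l / \<eta> < real L0" using reals_Archimedean2 by blast
  then have L: "4 * l / \<eta> < real (L0 + 1)" "1 \<le> L0 + 1" by auto
  define L where "L = L0 + 1"
  have lL: "l / real L \<le> \<eta> / 4" using L \<eta> by (simp add: L_def field_simps)
  obtain Q where Q: "\<And>n E. separated_set T X n e E \<Longrightarrow> card E \<le> complexity u (n + Q) * D ^ ((n + q) div L + 1)"
    using bound L(2) L_def by blast
  define K where "K = (r + \<eta> / 4) * real Q + real q * (\<eta> / 4) + l"
  have "\<forall>\<^sub>F n in sequentially. real (complexity u (n + Q)) \<le> exp ((r + \<eta> / 4) * real (n + Q))"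
    using growth[rule_format, of "\<eta> / 4"] \<eta> by (subst eventually_sequentially_seg) auto
  moreover have "\<forall>\<^sub>F n in sequentially. K / (\<eta> / 2) \<le> real n"
    using eventually_ge_at_top[of "nat \<lceil>K / (\<eta> / 2)\<rceil>"] by eventually_elim linarith
  moreover have "\<forall>\<^sub>F n in sequentially. 1 \<le> n" by (rule eventually_ge_at_top)
  ultimately have "\<forall>\<^sub>F n in sequentially. ereal (ln (real (max_separated T X n e)) / real n) \<le> ereal (r + \<eta>)"
  proof eventually_elim
    case (elim n)
    let ?M = "max_separated T X n e"
    have "ln (real ?M) \<le> (r + \<eta>) * real n"
    proof (cases "?M = 0")
      case True then show ?thesis using r \<eta> by simp
    next
      case False
      have "real ?M \<le> real (complexity u (n + Q) * D ^ ((n + q) div L + 1))"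
        using max_separated_le[OF Q] by (simp only: of_nat_le_iff)
      also have "\<dots> = real (complexity u (n + Q)) * real D ^ ((n + q) div L + 1)" by (simp only: of_nat_mult of_nat_power)
      also have "\<dots> \<le> exp ((r + \<eta> / 4) * real (n + Q)) * real D ^ ((n + q) div L + 1)"
        using elim(1) by (intro mult_right_mono) auto
      finally have "ln (real ?M) \<le> ln (exp ((r + \<eta> / 4) * real (n + Q)) * real D ^ ((n + q) div L + 1))"
        using False D by (subst ln_le_cancel_iff) auto
      also have "\<dots> = (r + \<eta> / 4) * real (n + Q) + real ((n + q) div L + 1) * l"
        using D by (simp only: l_def ln_mult_pos exp_gt_zero zero_less_power ln_exp ln_realpow of_nat_0_less_iff)
      also have "real ((n + q) div L + 1) * l \<le> (real (n + q) / real L + 1) * l"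
        using of_nat_div_le_of_nat[of "n + q" L] l by (intro mult_right_mono) auto
      also have "\<dots> = real (n + q) * (l / real L) + l" by (simp add: field_simps)
      also have "\<dots> \<le> real (n + q) * (\<eta> / 4) + l" using lL by (intro add_right_mono mult_left_mono) auto
      also have "(r + \<eta> / 4) * real (n + Q) + (real (n + q) * (\<eta> / 4) + l) = (r + \<eta> / 2) * real n + K"
        by (simp add: K_def field_simps)
      also have "K \<le> \<eta> / 2 * real n" using elim(2) \<eta> by (simp add: field_simps)
      finally show ?thesis by (simp add: algebra_simps)
    qed
    then show ?case using elim(3) by (simp add: divide_le_eq)
  qed
  then show "limsup (\<lambda>n. ereal (ln (real (max_separated T X n e)) / real n)) \<le> ereal r + ereal \<eta>"
    by (intro Limsup_bounded) simp
qed

section \<open>The lower bound for the entropy\<close>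

lemma point_over_orbit:
  obtains y where "pt (shift p u) y \<in> X"
proof (cases "p > 0")
  case True
  then show ?thesis using that adm_gen shift_u_subshift pt_in_X by blast
next
  case False
  define M where "M = nat (- p)"
  have p: "p = - int M" using False by (simp add: M_def)
  show ?thesis by (rule that) (use centre_X[of M] in \<open>simp only: fibre_pt_def p\<close>)
qed

text \<open>One point is chosen over a representative of each word of length \<open>n\<close>.
  Different words differ at some time \<open>i < n\<close> in base coordinate 0, by at least 1, and
  uniform continuity turns this into a separation independent of \<open>n\<close>.\<close>

lemma entropy_ge:
  assumes r: "r > 0" and growth: "\<exists>\<^sub>F n in sequentially. exp (r * real n) \<le> real (complexity u n)"
  obtains e where "e > 0" "ereal r \<le> limsup (\<lambda>n. ereal (ln (real (max_separated T X n e)) / real n))"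
proof -
  have "uniformly_continuous_on X (\<lambda>x. x (base_ix 0))"
    by (rule compact_uniformly_continuous[OF continuous_on_coordinate compact_X])
  then obtain d where d: "d > 0" "\<And>x x'. x \<in> X \<Longrightarrow> x' \<in> X \<Longrightarrow> dist x' x < d \<Longrightarrow> dist (x' (base_ix 0)) (x (base_ix 0)) < 1"
    unfolding uniformly_continuous_on_def by (metis zero_less_one)
  \<comment> \<open>Uniform continuity gives distance at least \<open>d\<close>, whereas separation
    asks for strictly more than \<open>e\<close>.\<close>
  define e where "e = d / 2"
  have e: "e > 0" using d by (simp add: e_def)
  have "complexity u n \<le> max_separated T X n e" for n
  proof -
    have "\<exists>y. pt (shift p u) y \<in> X" for p using point_over_orbit[of p] by blast
    then obtain y where y: "\<And>p. pt (shift p u) (y p) \<in> X" by metis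
    define sec where "sec w = (let p = inv_into UNIV (\<lambda>p. window u p n) w in pt (shift p u) (y p))" for w
    have sec: "\<exists>p. window u p n = w \<and> sec w = pt (shift p u) (y p)" if "w \<in> language n" for w
      using that f_inv_into_f[of w "\<lambda>p. window u p n" UNIV] unfolding sec_def language_def Let_def by blast
    have far: "\<exists>i<n. dist ((T ^^ i) (sec w)) ((T ^^ i) (sec w')) > e"
      if w: "w \<in> language n" "w' \<in> language n" "w \<noteq> w'" for w w'
    proof -
      obtain p p' where p: "window u p n = w" "sec w = pt (shift p u) (y p)"
        and p': "window u p' n = w'" "sec w' = pt (shift p' u) (y p')"
        using sec w by meson
      obtain i where i: "i < n" "u (p + int i) \<noteq> u (p' + int i)"
        using w(3) p(1) p'(1) window_eq_iff[of u p n u p'] by auto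
      have adm: "adm (shift p u) (y p)" "adm (shift p' u) (y p')" using y pt_in_X by blast+
      have "(T ^^ i) (sec w) (base_ix 0) = real (u (p + int i))" "(T ^^ i) (sec w') (base_ix 0) = real (u (p' + int i))"
        unfolding p(2) p'(2) funpow_T[OF adm(1)] funpow_T[OF adm(2)] by (simp_all add: shift_def add.commute)
      moreover have "1 \<le> \<bar>real (u (p + int i)) - real (u (p' + int i))\<bar>" using i(2) by linarith
      ultimately have "\<not> dist ((T ^^ i) (sec w) (base_ix 0)) ((T ^^ i) (sec w') (base_ix 0)) < 1"
        by (simp add: dist_real_def)
      then have "\<not> dist ((T ^^ i) (sec w)) ((T ^^ i) (sec w')) < d"
        using d(2)[of "(T ^^ i) (sec w')" "(T ^^ i) (sec w)"] funpow_T_X y p(2) p'(2) by metis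
      then show ?thesis using i(1) d(1) unfolding e_def by (intro exI[of _ i]) linarith
    qed
    then have inj: "inj_on sec (language n)"
      using e by (intro inj_onI) (metis dist_self less_asym)
    have "separated_set T X n e (sec ` language n)"
      unfolding separated_set_def
    proof (intro conjI ballI impI)
      show "sec ` language n \<subseteq> X" using sec y by fastforce
    qed (use finite_language far in auto)
    moreover obtain B where "\<And>E. separated_set T X n e E \<Longrightarrow> card E \<le> B"
      using separated_card_bound[OF e] by (metis order_refl)
    ultimately have "card (sec ` language n) \<le> max_separated T X n e" by (intro max_separated_ge)
    then show ?thesis using inj by (simp add: card_image card_language)
  qed
  then have "\<exists>\<^sub>F n in sequentially. 1 \<le> n \<and> exp (r * real n) \<le> real (max_separated T X n e)"
    using frequently_eventually_frequently[OF growth eventually_ge_at_top[of 1]]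
    by (elim frequently_elim1) (meson of_nat_le_iff order_trans)
  then have freq: "\<exists>\<^sub>F n in sequentially. ereal r \<le> ereal (ln (real (max_separated T X n e)) / real n)"
  proof (rule frequently_elim1)
    fix n assume n: "1 \<le> n \<and> exp (r * real n) \<le> real (max_separated T X n e)"
    then have "r * real n \<le> ln (real (max_separated T X n e))"
      using ln_ge_iff exp_gt_zero order.strict_trans2 by metis
    then show "ereal r \<le> ereal (ln (real (max_separated T X n e)) / real n)"
      using n by (simp add: le_divide_eq)
  qed
  have "ereal r \<le> limsup (\<lambda>n. ereal (ln (real (max_separated T X n e)) / real n))"
  proof (rule ccontr)
    assume "\<not> ?thesis"
    then have "\<forall>\<^sub>F n in sequentially. ereal (ln (real (max_separated T X n e)) / real n) < ereal r"
      by (intro Limsup_lessD) simp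
    then have "\<forall>\<^sub>F n in sequentially. \<not> ereal r \<le> ereal (ln (real (max_separated T X n e)) / real n)"
      by eventually_elim simp
    then show False using freq unfolding frequently_def by simp
  qed
  then show thesis using that e by blast
qed

theorem topological_entropy_T:
  assumes "r > 0"
    "\<forall>\<eta>>0. \<forall>\<^sub>F n in sequentially. real (complexity u n) \<le> exp ((r + \<eta>) * real n)"
    "\<exists>\<^sub>F n in sequentially. exp (r * real n) \<le> real (complexity u n)"
  shows "topological_entropy T X = ereal r"
proof (rule antisym)
  show "topological_entropy T X \<le> ereal r"
    unfolding topological_entropy_def using entropy_le[OF assms(1,2)] by (intro SUP_least) auto
  obtain e where "e > 0" "ereal r \<le> limsup (\<lambda>n. ereal (ln (real (max_separated T X n e)) / real n))"
    using entropy_ge[OF assms(1,3)] .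
  then show "ereal r \<le> topological_entropy T X"
    unfolding topological_entropy_def by (intro SUP_upper2[of e]) auto
qed

end

section \<open>Aperiodicity from complexity, the one-point case, and the conclusion\<close>

lemma aperiodic_of_complexity:
  assumes r: "r > 0" and growth: "\<exists>\<^sub>F n in sequentially. exp (r * real n) \<le> real (complexity c n)"
    and p: "p \<noteq> 0"
  shows "shift p c \<noteq> c"
proof
  assume per: "shift p c = c"
  have nat_per: "shift (int t * p) c = c" for t
    by (induction t) (use per in \<open>auto simp: algebra_simps simp flip: shift_shift\<close>)
  have all_per: "shift (t * p) c = c" for t
  proof (cases "t \<ge> 0")
    case True then show ?thesis using nat_per[of "nat t"] by simp
  next
    case False
    then have "shift (- (t * p)) c = c" using nat_per[of "nat (- t)"] by simp
    then show ?thesis using shift_eq_iff by (metis minus_minus)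
  qed
  \<comment> \<open>A sequence with period \<open>p\<close> has at most \<open>\<bar>p\<bar>\<close>
    windows of each length, which contradicts exponential growth. The factor \<open>sgn p\<close>
    turns division by \<open>\<bar>p\<bar>\<close> into a multiple of \<open>p\<close>.\<close>
  have "range (\<lambda>q. window c q n) \<subseteq> (\<lambda>q. window c q n) ` {0..<\<bar>p\<bar>}" for n
  proof clarify
    fix q
    have "(q div \<bar>p\<bar> * sgn p) * p = q div \<bar>p\<bar> * \<bar>p\<bar>" by (simp add: abs_sgn mult.assoc mult.commute[of p])
    then have q: "q = q mod \<bar>p\<bar> + (q div \<bar>p\<bar> * sgn p) * p" by (simp only: mod_div_mult_eq)
    have "c (q + i) = c (q mod \<bar>p\<bar> + i)" for i
      using fun_cong[OF all_per[of "q div \<bar>p\<bar> * sgn p"], of "q mod \<bar>p\<bar> + i"] q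
      unfolding shift_def by (metis add.assoc add.commute)
    then have "window c q n = window c (q mod \<bar>p\<bar>) n" by (simp add: window_eq_iff)
    then show "window c q n \<in> (\<lambda>q. window c q n) ` {0..<\<bar>p\<bar>}" using p by auto
  qed
  then have "complexity c n \<le> nat \<bar>p\<bar>" for n
    unfolding complexity_def using surj_card_le[of "{0..<\<bar>p\<bar>}"] by fastforce
  then have "\<exists>\<^sub>F n in sequentially. exp (r * real n) \<le> real (nat \<bar>p\<bar>)"
    using growth by (elim frequently_elim1) (meson of_nat_le_iff order_trans)
  moreover have "\<forall>\<^sub>F n in sequentially. \<not> exp (r * real n) \<le> real (nat \<bar>p\<bar>)"
  proof -
    have "\<forall>\<^sub>F n in sequentially. real (nat \<bar>p\<bar>) / r \<le> real n"
      using eventually_ge_at_top[of "nat \<lceil>real (nat \<bar>p\<bar>) / r\<rceil>"] by eventually_elim linarith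
    then show ?thesis
    proof eventually_elim
      case (elim n)
      then have "real (nat \<bar>p\<bar>) \<le> r * real n" using r by (simp add: field_simps)
      then show ?case using exp_ge_add_one_self[of "r * real n"] by linarith
    qed
  qed
  ultimately show False unfolding frequently_def by simp
qed

lemma obtain_recurrent_sequence:
  assumes r: "r > 0"
  obtains u b where "recurrent_sequence u b"
    "\<forall>\<eta>>0. \<forall>\<^sub>F n in sequentially. real (complexity u n) \<le> exp ((r + \<eta>) * real n)"
    "\<exists>\<^sub>F n in sequentially. exp (r * real n) \<le> real (complexity u n)"
proof (rule uniformly_recurrent_with_complexity_rate[OF r])
  fix u :: "int \<Rightarrow> nat" and b assume u: "\<And>i. u i < b" "uniformly_recurrent u"
    "\<And>\<eta>. \<eta> > 0 \<Longrightarrow> \<forall>\<^sub>F n in sequentially. real (complexity u n) \<le> exp ((r + \<eta>) * real n)"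
    "\<exists>\<^sub>F n in sequentially. exp (r * real n) \<le> real (complexity u n)"
  have "recurrent_sequence u b"
    by unfold_locales (use u(1,2) aperiodic_of_complexity[OF r u(4)] in auto)
  then show thesis by (rule that) (use u in auto)
qed

text \<open>Settles entropy 0, since the word construction works with a positive rate.\<close>

lemma singleton_zero_entropy:
  "minimal_map id {a}" "topological_entropy id {a :: point} = 0"
proof -
  show "minimal_map id {a}" by (auto simp: minimal_map_def closure_insert)
  have "max_separated id {a} n e = 1" for n e
  proof (rule antisym)
    have bnd: "card E \<le> 1" if "separated_set id {a} n e E" for E
      using that card_mono[of "{a}" E] by (simp add: separated_set_def)
    then show "max_separated id {a} n e \<le> 1" by (rule max_separated_le)
    have "separated_set id {a} n e {a}" by (simp add: separated_set_def)
    then show "1 \<le> max_separated id {a} n e" using max_separated_ge[of id "{a}" n e 1 "{a}"] bnd by simp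
  qed
  then show "topological_entropy id {a} = 0"
    by (simp add: topological_entropy_def Limsup_const zero_ereal_def[symmetric])
qed

theorem theorem4p1:
  shows "(\<exists>F :: point set set. uncountable F \<and>
            (\<forall>X\<in>F. compact X \<and> X \<noteq> {} \<and> minimal_space X \<and> degenerate_homeo_group X) \<and>
            (\<forall>X\<in>F. \<forall>Y\<in>F. X \<noteq> Y \<longrightarrow> \<not> (X homeomorphic Y)))
       \<and> (\<forall>r::real. r \<ge> 0 \<longrightarrow>
            (\<exists>X :: point set. compact X \<and> X \<noteq> {} \<and> degenerate_homeo_group X \<and>
               (\<exists>f. minimal_map f X \<and> topological_entropy f X = ereal r)))"
proof (intro conjI allI impI)
  \<comment> \<open>Any positive rate would do for the first claim.\<close>
  obtain u b where "recurrent_sequence u b" by (rule obtain_recurrent_sequence[of 1]) auto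
  then interpret recurrent_sequence u b .
  \<comment> \<open>Each \<open>m\<close> owns the two values \<open>3 + 2 * m\<close> and
    \<open>4 + 2 * m\<close>, so \<open>N A\<close> is strictly increasing for every
    \<open>A\<close>, and the even values in its range are exactly the marks of the members of
    \<open>A\<close>.\<close>
  define N where "N A m = 3 + 2 * m + (if m \<in> A then 1 else 0)" for A :: "nat set" and m :: nat
  have ext: "star_extension u b (N A)" for A
    by unfold_locales (auto simp: N_def strict_mono_Suc_iff)
  define S where "S A = star_extension.X u (N A)" for A
  have branch: "{n. 3 \<le> n \<and> (\<exists>x\<in>S A. branch_number (S A) x = n)} = range (N A)" for A
    unfolding S_def by (rule star_extension.branch_numbers[OF ext])
  have mem_iff: "m \<in> A \<longleftrightarrow> 4 + 2 * m \<in> range (N A)" for A m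
  proof
    assume "m \<in> A"
    then have "4 + 2 * m = N A m" by (simp add: N_def)
    then show "4 + 2 * m \<in> range (N A)" by blast
  next
    assume "4 + 2 * m \<in> range (N A)"
    then obtain k where "4 + 2 * m = N A k" by blast
    then have k: "4 + 2 * m = 3 + 2 * k + (if k \<in> A then 1 else 0)" by (simp only: N_def)
    show "m \<in> A"
    proof (cases "k \<in> A")
      case True then show ?thesis using k by simp
    next
      case False
      then have "4 + 2 * m = 3 + 2 * k" using k by simp
      then have False by presburger
      then show ?thesis ..
    qed
  qed
  have distinct: "A = B" if "S A homeomorphic S B" for A B
  proof -
    have "range (N A) = range (N B)"
      using branch[of A] branch[of B] branch_numbers_homeomorphic[OF that] by auto
    then show ?thesis using mem_iff[of _ A] mem_iff[of _ B] by (intro set_eqI) simp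
  qed
  then have "inj S" by (metis homeomorphic_refl injI)
  moreover have "uncountable (UNIV :: nat set set)"
    using Cantors_theorem[of "UNIV :: nat set"] unfolding uncountable_def by auto
  ultimately have "uncountable (range S)" using countable_image_inj_eq by blast
  moreover have "compact (S A)" "S A \<noteq> {}" "minimal_space (S A)" "degenerate_homeo_group (S A)" for A
    unfolding S_def minimal_space_def
    using star_extension.compact_X[OF ext] star_extension.X_nonempty[OF ext]
      star_extension.minimal_T[OF ext] star_extension.degenerate_X[OF ext] by blast+
  ultimately show "\<exists>F :: point set set. uncountable F \<and>
            (\<forall>X\<in>F. compact X \<and> X \<noteq> {} \<and> minimal_space X \<and> degenerate_homeo_group X) \<and>
            (\<forall>X\<in>F. \<forall>Y\<in>F. X \<noteq> Y \<longrightarrow> \<not> (X homeomorphic Y))"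
    by (intro exI[of _ "range S"]) (auto dest: distinct)
next
  fix r :: real assume "r \<ge> 0"
  show "\<exists>X :: point set. compact X \<and> X \<noteq> {} \<and> degenerate_homeo_group X \<and>
               (\<exists>f. minimal_map f X \<and> topological_entropy f X = ereal r)"
  proof (cases "r = 0")
    case True
    have "degenerate_homeo_group {\<lambda>_. 0 :: real}"
      by (auto simp: degenerate_homeo_group_def homeomorphism_def)
    then show ?thesis
      using True singleton_zero_entropy[of "\<lambda>_. 0"] by (intro exI[of _ "{\<lambda>_. 0}"]) auto
  next
    case False
    then have r: "r > 0" using \<open>r \<ge> 0\<close> by simp
    obtain u b where u: "recurrent_sequence u b"
      "\<forall>\<eta>>0. \<forall>\<^sub>F n in sequentially. real (complexity u n) \<le> exp ((r + \<eta>) * real n)"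
      "\<exists>\<^sub>F n in sequentially. exp (r * real n) \<le> real (complexity u n)"
      by (rule obtain_recurrent_sequence[OF r])
    interpret recurrent_sequence u b by (rule u(1))
    interpret star_extension u b "\<lambda>m. 3 + m"
      by unfold_locales (auto simp: strict_mono_Suc_iff)
    show ?thesis
      using compact_X X_nonempty degenerate_X minimal_T topological_entropy_T[OF r u(2,3)] by blast
  qed
qed

end
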